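(* Let $d\ge2$ and consider the $S=\frac12$ quantum spin system on $\mathbb Z^d$ with formal Hamiltonian $$\hat H=-\frac12\sum_{u,v\in\mathbb Z^d,\ |u-v|=1}\{J_{\mathrm X}\hat X_u\hat X_v+J_{\mathrm Y}\hat Y_u\hat Y_v+J_{\mathrm Z}\hat Z_u\hat Z_v\}-\sum_{u\in\mathbb Z^d}\{h_{\mathrm X}\hat X_u+h_{\mathrm Y}\hat Y_u+h_{\mathrm Z}\hat Z_u\},$$ with real parameters such that $J_{\mathrm X}\ne0$ and $J_{\mathrm Y}\neq0$. Then there exist a constant $\alpha>0$ and an infinite set $G$ of positive integers such that the Lanczos coefficients $b_n$ for the initial operator $\hat X_o$ ($o$ the origin of $\mathbb Z^d$) satisfy $$\prod_{j=1}^n b_j\ \ge\ \alpha^n\,n!\qquad\text{for every } n\in G.$$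
   Context: $\hat X_u,\hat Y_u,\hat Z_u$ are the Pauli matrices at site $u$; $|u-v|$ is the Euclidean distance. A product of Pauli matrices is $\bigotimes_{u\in S}\hat A_u$ with $S\subset\mathbb Z^d$ finite nonempty and $\hat A_u\in\{\hat X_u,\hat Y_u,\hat Z_u\}$; a local operator is a finite linear combination of products (and the identity). The commutator $[\hat H,\hat A]$ of the formal Hamiltonian with a local operator $\hat A$ is defined as the sum of commutators of $\hat A$ with those (finitely many) terms of $\hat H$ whose support meets the support of $\hat A$. Inner product of local operators: $\langle\hat A,\hat B\rangle=\rho_\infty(\hat A^\dagger\hat B)$, where $\rho_\infty(\hat A)=\operatorname{Tr}_{\mathcal H_S}[\hat A]/\operatorname{Tr}_{\mathcal H_S}[\hat I]$ for any finite $S$ containing the support of $\hat A$, with $\mathcal H_S=\bigotimes_{u\in S}\mathbb C^2$ (products of Pauli matrices are orthonormal). Lanczos coefficients for a self-adjoint initial local operator $\hat B_0$ with $\langle\hat B_0,\hat B_0\rangle=1$: put $\hat B_n=\mathrm i[\hat H,\hat B_{n-1}]$ for $n\ge1$. Assuming $\hat B_0,\dots,\hat B_n$ are linearly independent for all $n$ (which is the case here), let $\hat C_0=\hat B_0$ and, for $n\ge1$, let $\hat C_n$ be the unique operator of the form $\hat C_n=\hat B_n+\sum_{j=0}^{n-1}\alpha^{(n)}_j\hat B_j$ with $\langle\hat C_n,\hat C_j\rangle=0$ for all $j=0,\dots,n-1$. Then $$b_n=\sqrt{\frac{\langle\hat C_n,\hat C_n\rangle}{\langle\hat C_{n-1},\hat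 C_{n-1}\rangle}}\quad(n\ge1),\qquad\text{equivalently}\quad \prod_{j=1}^nb_j=\sqrt{\langle\hat C_n,\hat C_n\rangle}.$$ *)

theory Defs
  imports "HOL-Analysis.Analysis" "HOL-Library.Function_Algebras"
begin

text \<open>
  The spin algebra on the lattice of integer vectors \<^typ>\<open>int ^ 'd\<close>, with \<^typ>\<open>'d\<close> the index type of
  the coordinates. The standard basis of \<^typ>\<open>complex ^ 2\<close> at each site is labelled by the
  two-element type \<^typ>\<open>2\<close>, so a basis configuration assigns an element of \<^typ>\<open>2\<close> to every site.
  A local operator is represented by its matrix elements between configurations of the whole
  lattice: an operator on a finite region, tensored with the identity on all other sites. Operators
  with different supports thus live in one type and are identified exactly when they agree
  after tensoring with the identity. Addition, subtraction and zero of operators are the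
  pointwise ones; multiplication is \<open>op_mult\<close> (not the pointwise product of functions).
\<close>

type_synonym 'd site = "int ^ 'd"
type_synonym 'd config = "'d site \<Rightarrow> 2"
type_synonym 'd oper = "'d config \<Rightarrow> 'd config \<Rightarrow> complex"

definition op_id :: "'d oper" where
  "op_id = (\<lambda>\<sigma> \<tau>. if \<sigma> = \<tau> then 1 else 0)"

definition op_scale :: "complex \<Rightarrow> 'd oper \<Rightarrow> 'd oper"  (infixr "*\<^sub>o" 75) where
  "c *\<^sub>o A = (\<lambda>\<sigma> \<tau>. c * A \<sigma> \<tau>)"

text \<open>Matrix product. A local operator has finitely many nonzero entries in each row, so
  for local \<open>A\<close> the index set of the sum is finite.\<close>

definition op_mult :: "'d oper \<Rightarrow> 'd oper \<Rightarrow> 'd oper"  (infixl "\<odot>" 70) where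
  "A \<odot> B = (\<lambda>\<sigma> \<tau>. \<Sum>\<rho> | A \<sigma> \<rho> \<noteq> 0. A \<sigma> \<rho> * B \<rho> \<tau>)"

definition op_adj :: "'d oper \<Rightarrow> 'd oper" where
  "op_adj A = (\<lambda>\<sigma> \<tau>. cnj (A \<tau> \<sigma>))"

definition op_commutator :: "'d oper \<Rightarrow> 'd oper \<Rightarrow> 'd oper" where
  "op_commutator A B = A \<odot> B - B \<odot> A"

definition pauli_X :: "complex ^ 2 ^ 2" where
  "pauli_X = vector [vector [0, 1], vector [1, 0]]"

definition pauli_Y :: "complex ^ 2 ^ 2" where
  "pauli_Y = vector [vector [0, - \<i>], vector [\<i>, 0]]"

definition pauli_Z :: "complex ^ 2 ^ 2" where
  "pauli_Z = vector [vector [1, 0], vector [0, - 1]]"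

text \<open>The tensor product of the matrices \<open>M u\<close> over \<open>u \<in> S\<close> (and the identity at all other sites).\<close>

definition tensor :: "'d site set \<Rightarrow> ('d site \<Rightarrow> complex ^ 2 ^ 2) \<Rightarrow> 'd oper" where
  "tensor S M = (\<lambda>\<sigma> \<tau>. if \<forall>u. u \<notin> S \<longrightarrow> \<sigma> u = \<tau> u
     then \<Prod>u\<in>S. M u $ \<sigma> u $ \<tau> u else 0)"

definition at_site :: "complex ^ 2 ^ 2 \<Rightarrow> 'd site \<Rightarrow> 'd oper" where
  "at_site M u = tensor {u} (\<lambda>_. M)"

text \<open>Products of Pauli matrices with support contained in \<open>S\<close>; the empty product is the identity.\<close>

definition pauli_products :: "'d site set \<Rightarrow> 'd oper set" where
  "pauli_products S = {tensor T M | T M. finite T \<and> T \<subseteq> S \<and>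
     (\<forall>u\<in>T. M u \<in> {pauli_X, pauli_Y, pauli_Z})}"

definition local_on :: "'d site set \<Rightarrow> 'd oper \<Rightarrow> bool" where
  "local_on S A \<longleftrightarrow> (\<exists>F c. finite F \<and> F \<subseteq> pauli_products S \<and> A = (\<Sum>P\<in>F. c P *\<^sub>o P))"

definition op_supp :: "'d oper \<Rightarrow> 'd site set" where
  "op_supp A = \<Inter> {S. finite S \<and> local_on S A}"

text \<open>Trace over the Hilbert space of the region \<open>S\<close>: the configurations on \<open>S\<close> are those of the
  lattice with the sites outside \<open>S\<close> frozen (to \<open>1\<close>, an arbitrary choice).\<close>

definition op_trace :: "'d site set \<Rightarrow> 'd oper \<Rightarrow> complex" where
  "op_trace S A = (\<Sum>\<sigma> | \<forall>u. u \<notin> S \<longrightarrow> \<sigma> u = 1. A \<sigma> \<sigma>)"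

definition rho_inf :: "'d oper \<Rightarrow> complex" where
  "rho_inf A = (THE z. \<forall>S. finite S \<and> op_supp A \<subseteq> S \<longrightarrow> z = op_trace S A / op_trace S op_id)"

definition op_inner :: "'d oper \<Rightarrow> 'd oper \<Rightarrow> complex" where
  "op_inner A B = rho_inf (op_adj A \<odot> B)"

text \<open>Commutator of \<open>A\<close> with the formal sum of the operators \<open>h i\<close> over \<open>i \<in> I\<close>.\<close>

definition formal_commutator :: "'i set \<Rightarrow> ('i \<Rightarrow> 'd oper) \<Rightarrow> 'd oper \<Rightarrow> 'd oper" where
  "formal_commutator I h A =
     (\<Sum>i | i \<in> I \<and> op_supp (h i) \<inter> op_supp A \<noteq> {}. op_commutator (h i) A)"

definition site_dist :: "('d::finite) site \<Rightarrow> 'd site \<Rightarrow> real" where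
  "site_dist u v = norm ((\<chi> i. real_of_int (u $ i - v $ i)) :: real ^ 'd)"

definition bond_term :: "real \<Rightarrow> real \<Rightarrow> real \<Rightarrow> 'd site \<times> 'd site \<Rightarrow> 'd oper" where
  "bond_term JX JY JZ = (\<lambda>(u, v). complex_of_real (- 1 / 2) *\<^sub>o
     (complex_of_real JX *\<^sub>o (at_site pauli_X u \<odot> at_site pauli_X v) +
      complex_of_real JY *\<^sub>o (at_site pauli_Y u \<odot> at_site pauli_Y v) +
      complex_of_real JZ *\<^sub>o (at_site pauli_Z u \<odot> at_site pauli_Z v)))"

definition field_term :: "real \<Rightarrow> real \<Rightarrow> real \<Rightarrow> 'd site \<Rightarrow> 'd oper" where
  "field_term hX hY hZ u = - (complex_of_real hX *\<^sub>o at_site pauli_X u +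
      complex_of_real hY *\<^sub>o at_site pauli_Y u + complex_of_real hZ *\<^sub>o at_site pauli_Z u)"

text \<open>The bonds are ordered pairs, so each unordered bond occurs twice, with the factor \<open>1/2\<close>.\<close>

definition ham_commutator ::
  "real \<Rightarrow> real \<Rightarrow> real \<Rightarrow> real \<Rightarrow> real \<Rightarrow> real \<Rightarrow> ('d::finite) oper \<Rightarrow> 'd oper" where
  "ham_commutator JX JY JZ hX hY hZ A =
     formal_commutator {(u, v). site_dist u v = 1} (bond_term JX JY JZ) A +
     formal_commutator UNIV (field_term hX hY hZ) A"

text \<open>In the following, \<open>L\<close> is the map taking \<open>A\<close> to the commutator of the Hamiltonian with \<open>A\<close>,
  and \<open>B0\<close> is the initial operator.\<close>

primrec krylov_B :: "('d oper \<Rightarrow> 'd oper) \<Rightarrow> 'd oper \<Rightarrow> nat \<Rightarrow> 'd oper" where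
  "krylov_B L B0 0 = B0"
| "krylov_B L B0 (Suc n) = \<i> *\<^sub>o L (krylov_B L B0 n)"

fun lanczos_C :: "('d oper \<Rightarrow> 'd oper) \<Rightarrow> 'd oper \<Rightarrow> nat \<Rightarrow> 'd oper" where
  "lanczos_C L B0 n = (THE C.
     (\<exists>\<alpha>. C = krylov_B L B0 n + (\<Sum>j<n. \<alpha> j *\<^sub>o krylov_B L B0 j)) \<and>
     (\<forall>j\<in>{..<n}. op_inner C (lanczos_C L B0 j) = 0))"

declare lanczos_C.simps [simp del]

text \<open>The inner product of an operator with itself is real and nonnegative, hence \<^const>\<open>Re\<close>.
  If the Krylov operators are linearly dependent, then some \<open>b\<close> vanishes (division by zero
  gives zero).\<close>

definition lanczos_b :: "('d oper \<Rightarrow> 'd oper) \<Rightarrow> 'd oper \<Rightarrow> nat \<Rightarrow> real" where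
  "lanczos_b L B0 n =
     sqrt (Re (op_inner (lanczos_C L B0 n) (lanczos_C L B0 n)) /
           Re (op_inner (lanczos_C L B0 (n - 1)) (lanczos_C L B0 (n - 1))))"

end

(*
  Since C_n - B_n lies in the span of B_0, ..., B_(n-1), any product of Pauli matrices P that does
  not occur in B_0, ..., B_(n-1) gives the bound b_1 ... b_n = |C_n| >= |coefficient of P in B_n|.

  A commutator with a bond term enlarges a support by at most one site, so a product P with
  n + 1 sites occurs in B_n only if every step adds a site. If the support U of P is a tree in the
  lattice containing the origin, then the steps that lead to P are the ways of growing U site by
  site from the origin. Take every site to be created by an XX bond or a YY bond according to the
  parity of the sum of its coordinates. Then a site shows X or Y while it has an even number of
  children, and Z otherwise, each new child multiplies the coefficient by a factor of modulus 2 |J|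
  which depends only on the number of earlier children, and hence all growth orders contribute with
  the same phase. The coefficient therefore has modulus at least (2 min |J|)^n times the number of
  growth orders.

  It remains to find trees with at least c^n n! growth orders. In a quadrant of a coordinate plane
  let every edge lead away from the origin; such a set is a tree when no site has both its left and
  its lower neighbour in the set. Joining two copies of a tree with N sites by a stem of length about
  the width w gives (2N choose N) times the square of the number of orders, and loses only a factor
  N^O(w) against the factorial. Doubling the two sides of the bounding box alternately keeps w of order
  sqrt N, and the losses remain exponential in N.
*)
theory Submission
  imports Defs
begin

text \<open>The definitions reach operators through infinite matrices, intersections of regions and
  definite descriptions. They become computable once a local operator is replaced by its finitely
  many coefficients on Pauli strings: traces recover the coefficients, so nothing is lost, and a
  commutator with one string either kills another string or moves it to exactly one string. The
  danger in counting histories is cancellation. In a support with a cycle a site could be attached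
  through different bonds, with different signs and different matrices at the neighbours; a tree
  leaves only one choice. The alternation of XX and YY makes each new bond anticommute with either
  of the two matrices that its older end can show, so no growth order is lost to a vanishing
  commutator. The remaining couplings cannot interfere: a field term never enlarges a support, and a
  ZZ bond would leave Z on a new leaf, where the pattern has X or Y. Nor is any tree good enough: a
  path started at its end has a single growth order, so long stems must be rare.\<close>

section \<open>Pauli matrices at a single site\<close>

datatype pauli = PI | PX | PY | PZ

text \<open>The Klein four-group, whose law the Pauli matrices obey up to the phases
  \<open>pauli_phase\<close>.\<close>

fun pauli_mult :: "pauli \<Rightarrow> pauli \<Rightarrow> pauli" where
  "pauli_mult PI b = b"
| "pauli_mult a PI = a"
| "pauli_mult PX PX = PI" | "pauli_mult PX PY = PZ" | "pauli_mult PX PZ = PY"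
| "pauli_mult PY PX = PZ" | "pauli_mult PY PY = PI" | "pauli_mult PY PZ = PX"
| "pauli_mult PZ PX = PY" | "pauli_mult PZ PY = PX" | "pauli_mult PZ PZ = PI"

fun pauli_phase :: "pauli \<Rightarrow> pauli \<Rightarrow> complex" where
  "pauli_phase PX PY = \<i>" | "pauli_phase PY PX = - \<i>"
| "pauli_phase PY PZ = \<i>" | "pauli_phase PZ PY = - \<i>"
| "pauli_phase PZ PX = \<i>" | "pauli_phase PX PZ = - \<i>"
| "pauli_phase a b = 1"

primrec pauli_mat :: "pauli \<Rightarrow> complex ^ 2 ^ 2" where
  "pauli_mat PI = mat 1"
| "pauli_mat PX = pauli_X"
| "pauli_mat PY = pauli_Y"
| "pauli_mat PZ = pauli_Z"

lemma pauli_mult_PI [simp]: "pauli_mult a PI = a"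
  by (cases a) auto

lemma pauli_mult_self [simp]: "pauli_mult a a = PI"
  by (cases a) auto

lemma pauli_mult_cancel [simp]: "pauli_mult a (pauli_mult a b) = b"
  by (cases a; cases b) auto

lemma pauli_mult_commute: "pauli_mult a b = pauli_mult b a"
  by (cases a; cases b) auto

lemma pauli_mult_eq_PI_iff [simp]: "pauli_mult a b = PI \<longleftrightarrow> a = b"
  by (cases a; cases b) auto

lemma pauli_phase_PI [simp]: "pauli_phase PI a = 1" "pauli_phase a PI = 1"
  "pauli_phase a a = 1"
  by (cases a; simp)+

lemma pauli_mat_mult:
  "pauli_mat a ** pauli_mat b = (\<chi> i j. pauli_phase a b * pauli_mat (pauli_mult a b) $ i $ j)"
  by (cases a; cases b)
    (simp_all add: vec_eq_iff forall_2 matrix_matrix_mult_def sum_2 pauli_X_def pauli_Y_def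
      pauli_Z_def mat_def)

lemma pauli_mat_hermitian: "cnj (pauli_mat a $ i $ j) = pauli_mat a $ j $ i"
  using exhaust_2[of i] exhaust_2[of j]
  by (cases a) (auto simp: pauli_X_def pauli_Y_def pauli_Z_def mat_def)

lemma trace_pauli_mat: "(\<Sum>i\<in>UNIV. pauli_mat a $ i $ i) = (if a = PI then 2 else 0)"
  by (cases a) (simp_all add: sum_2 pauli_X_def pauli_Y_def pauli_Z_def mat_def)

section \<open>Pauli strings and their phases\<close>

type_synonym 'd string = "'d site \<Rightarrow> pauli"

definition supp :: "'d string \<Rightarrow> 'd site set" where
  "supp s = {u. s u \<noteq> PI}"

definition smult :: "'d string \<Rightarrow> 'd string \<Rightarrow> 'd string"  (infixl "\<cdot>" 70) where
  "s \<cdot> t = (\<lambda>u. pauli_mult (s u) (t u))"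

definition sphase :: "'d string \<Rightarrow> 'd string \<Rightarrow> complex" where
  "sphase s t = (\<Prod>u\<in>supp s \<inter> supp t. pauli_phase (s u) (t u))"

definition sid :: "'d string" where
  "sid = (\<lambda>_. PI)"

text \<open>The region is the exact support, so that a string of finite support is one of the
  \<open>pauli_products\<close> as it stands.\<close>

definition pstr :: "'d string \<Rightarrow> 'd oper" where
  "pstr s = tensor (supp s) (\<lambda>u. pauli_mat (s u))"

lemma smult_cancel [simp]: "s \<cdot> (s \<cdot> t) = t"
  by (simp add: smult_def)

lemma smult_commute: "s \<cdot> t = t \<cdot> s"
  by (simp add: smult_def pauli_mult_commute)

lemma smult_self [simp]: "s \<cdot> s = sid"
  by (simp add: smult_def sid_def)

lemma smult_sid [simp]: "s \<cdot> sid = s"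
  by (simp add: smult_def sid_def)

lemma supp_smult: "supp (s \<cdot> t) \<subseteq> supp s \<union> supp t"
  by (auto simp: supp_def smult_def)

lemma supp_sid [simp]: "supp sid = {}"
  by (simp add: supp_def sid_def)

lemma finite_supp_smult [simp]: "finite (supp s) \<Longrightarrow> finite (supp t) \<Longrightarrow> finite (supp (s \<cdot> t))"
  using supp_smult[of s t] by (auto intro: finite_subset)

lemma finite_supp_smult_iff:
  assumes "finite (supp s)"
  shows "finite (supp (s \<cdot> t)) \<longleftrightarrow> finite (supp t)"
  using assms finite_supp_smult[of s t] finite_supp_smult[of s "s \<cdot> t"]
  by (auto simp only: smult_cancel)

lemma sphase_eq_prod:
  assumes "finite S" "supp s \<inter> supp t \<subseteq> S"
  shows "sphase s t = (\<Prod>u\<in>S. pauli_phase (s u) (t u))"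
  unfolding sphase_def
  using assms by (intro prod.mono_neutral_left) (auto simp: supp_def)

lemma sphase_self [simp]: "sphase s s = 1"
  by (simp add: sphase_def)

lemma sphase_disjoint:
  assumes "supp s \<inter> supp t = {}"
  shows "sphase s t = 1"
  using assms by (simp add: sphase_def)

section \<open>Matrix elements of tensor products\<close>

definition patch :: "'d site set \<Rightarrow> 'd config \<Rightarrow> 'd config \<Rightarrow> 'd config" where
  "patch S \<sigma> f = (\<lambda>u. if u \<in> S then f u else \<sigma> u)"

text \<open>Extensional functions on \<open>S\<close> parametrise the configurations that agree with
  \<sigma> off \<open>S\<close>; over such functions a sum of products factorises.\<close>

lemma patch_bij_betw:
  "bij_betw (patch S \<sigma>) (S \<rightarrow>\<^sub>E UNIV) {\<rho>. \<forall>u. u \<notin> S \<longrightarrow> \<rho> u = \<sigma> u}"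
proof (rule bij_betwI[where g = "\<lambda>\<rho>. restrict \<rho> S"])
  show "patch S \<sigma> \<in> (S \<rightarrow>\<^sub>E UNIV) \<rightarrow> {\<rho>. \<forall>u. u \<notin> S \<longrightarrow> \<rho> u = \<sigma> u}"
    by (auto simp: patch_def)
  show "(\<lambda>\<rho>. restrict \<rho> S) \<in> {\<rho>. \<forall>u. u \<notin> S \<longrightarrow> \<rho> u = \<sigma> u} \<rightarrow> (S \<rightarrow>\<^sub>E UNIV)"
    by auto
  show "restrict (patch S \<sigma> f) S = f" if "f \<in> S \<rightarrow>\<^sub>E UNIV" for f
    using that by (auto simp: patch_def fun_eq_iff PiE_def extensional_def)
  show "patch S \<sigma> (restrict \<rho> S) = \<rho>" if "\<rho> \<in> {\<rho>. \<forall>u. u \<notin> S \<longrightarrow> \<rho> u = \<sigma> u}" for \<rho>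
    using that by (auto simp: patch_def fun_eq_iff)
qed

lemma finite_patch_set:
  assumes "finite S"
  shows "finite {\<rho> :: 'd config. \<forall>u. u \<notin> S \<longrightarrow> \<rho> u = \<sigma> u}"
  using assms bij_betw_finite[OF patch_bij_betw[of S \<sigma>]] by (simp add: finite_PiE)

lemma sum_patch_set:
  fixes g :: "'d site \<Rightarrow> 2 \<Rightarrow> complex"
  assumes "finite S"
  shows "(\<Sum>\<rho> | \<forall>u. u \<notin> S \<longrightarrow> \<rho> u = \<sigma> u. \<Prod>u\<in>S. g u (\<rho> u)) = (\<Prod>u\<in>S. \<Sum>i\<in>UNIV. g u i)"
proof -
  have "(\<Sum>\<rho> | \<forall>u. u \<notin> S \<longrightarrow> \<rho> u = \<sigma> u. \<Prod>u\<in>S. g u (\<rho> u))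
      = (\<Sum>f \<in> S \<rightarrow>\<^sub>E UNIV. \<Prod>u\<in>S. g u (patch S \<sigma> f u))"
    by (rule sum.reindex_bij_betw[OF patch_bij_betw, symmetric])
  also have "\<dots> = (\<Sum>f \<in> S \<rightarrow>\<^sub>E UNIV. \<Prod>u\<in>S. g u (f u))"
    by (intro sum.cong prod.cong refl) (simp add: patch_def)
  also have "\<dots> = (\<Prod>u\<in>S. \<Sum>i\<in>UNIV. g u i)"
    using assms by (subst prod_sum_PiE) auto
  finally show ?thesis .
qed

definition row_finite :: "'d oper \<Rightarrow> bool" where
  "row_finite A \<longleftrightarrow> (\<forall>\<sigma>. finite {\<rho>. A \<sigma> \<rho> \<noteq> 0})"

lemma op_mult_eq_sum:
  assumes "finite R" "{\<rho>. A \<sigma> \<rho> \<noteq> 0} \<subseteq> R"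
  shows "(A \<odot> B) \<sigma> \<tau> = (\<Sum>\<rho>\<in>R. A \<sigma> \<rho> * B \<rho> \<tau>)"
  unfolding op_mult_def using assms by (intro sum.mono_neutral_left) auto

lemma tensor_row_subset:
  "{\<rho>. tensor S M \<sigma> \<rho> \<noteq> 0} \<subseteq> {\<rho>. \<forall>u. u \<notin> S \<longrightarrow> \<rho> u = \<sigma> u}"
  by (auto simp: tensor_def split: if_splits)

lemma row_finite_tensor:
  assumes "finite S"
  shows "row_finite (tensor S M)"
  unfolding row_finite_def
  by (intro allI finite_subset[OF tensor_row_subset] finite_patch_set assms)

lemma tensor_mult:
  assumes "finite S"
  shows "tensor S M \<odot> tensor S N = tensor S (\<lambda>u. M u ** N u)"
proof (intro ext)
  fix \<sigma> \<tau> :: "'a config"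
  let ?R = "{\<rho>. \<forall>u. u \<notin> S \<longrightarrow> \<rho> u = \<sigma> u}"
  have if_sum: "(\<Sum>\<rho>\<in>R. if P then h \<rho> else 0) = (if P then \<Sum>\<rho>\<in>R. h \<rho> else 0)"
    for R :: "'a config set" and P and h :: "'a config \<Rightarrow> complex"
    by simp
  have "(tensor S M \<odot> tensor S N) \<sigma> \<tau> = (\<Sum>\<rho>\<in>?R. tensor S M \<sigma> \<rho> * tensor S N \<rho> \<tau>)"
    using finite_patch_set[OF assms] tensor_row_subset by (rule op_mult_eq_sum)
  also have "\<dots> = (\<Sum>\<rho>\<in>?R. if \<forall>u. u \<notin> S \<longrightarrow> \<sigma> u = \<tau> u
      then \<Prod>u\<in>S. M u $ \<sigma> u $ \<rho> u * N u $ \<rho> u $ \<tau> u else 0)"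
    by (intro sum.cong refl) (auto simp: tensor_def prod.distrib)
  also have "\<dots> = (if \<forall>u. u \<notin> S \<longrightarrow> \<sigma> u = \<tau> u
      then \<Sum>\<rho>\<in>?R. \<Prod>u\<in>S. M u $ \<sigma> u $ \<rho> u * N u $ \<rho> u $ \<tau> u else 0)"
    by (rule if_sum)
  also have "(\<Sum>\<rho>\<in>?R. \<Prod>u\<in>S. M u $ \<sigma> u $ \<rho> u * N u $ \<rho> u $ \<tau> u)
      = (\<Prod>u\<in>S. \<Sum>i\<in>UNIV. M u $ \<sigma> u $ i * N u $ i $ \<tau> u)"
    by (rule sum_patch_set[OF assms, where g = "\<lambda>u i. M u $ \<sigma> u $ i * N u $ i $ \<tau> u"])
  also have "(if \<forall>u. u \<notin> S \<longrightarrow> \<sigma> u = \<tau> u then \<dots> else 0) = tensor S (\<lambda>u. M u ** N u) \<sigma> \<tau>"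
    by (auto simp add: tensor_def matrix_matrix_mult_def)
  finally show "(tensor S M \<odot> tensor S N) \<sigma> \<tau> = tensor S (\<lambda>u. M u ** N u) \<sigma> \<tau>" .
qed

lemma op_trace_tensor:
  assumes "finite S"
  shows "op_trace S (tensor S M) = (\<Prod>u\<in>S. \<Sum>i\<in>UNIV. M u $ i $ i)"
proof -
  have "op_trace S (tensor S M) = (\<Sum>\<sigma> | \<forall>u. u \<notin> S \<longrightarrow> \<sigma> u = 1. \<Prod>u\<in>S. M u $ \<sigma> u $ \<sigma> u)"
    unfolding op_trace_def by (intro sum.cong refl) (simp add: tensor_def)
  also have "\<dots> = (\<Prod>u\<in>S. \<Sum>i\<in>UNIV. M u $ i $ i)"
    by (rule sum_patch_set[OF assms, where g = "\<lambda>u i. M u $ i $ i" and \<sigma> = "\<lambda>_. 1"])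
  finally show ?thesis .
qed

text \<open>Off the support the factors are identity matrices, whose entries enforce the equality of
  \<sigma> and \<tau> there. Two strings can thus be written over a common region.\<close>

lemma pstr_eq_tensor:
  assumes "finite S" "supp s \<subseteq> S"
  shows "pstr s = tensor S (\<lambda>u. pauli_mat (s u))"
proof (intro ext)
  fix \<sigma> \<tau> :: "'a config"
  have I: "pauli_mat (s u) $ \<sigma> u $ \<tau> u = (if \<sigma> u = \<tau> u then 1 else 0)" if "u \<notin> supp s" for u
    using that by (simp add: supp_def mat_def)
  show "pstr s \<sigma> \<tau> = tensor S (\<lambda>u. pauli_mat (s u)) \<sigma> \<tau>"
  proof (cases "\<forall>u. u \<notin> supp s \<longrightarrow> \<sigma> u = \<tau> u")
    case True
    then have "(\<Prod>u\<in>supp s. pauli_mat (s u) $ \<sigma> u $ \<tau> u) = (\<Prod>u\<in>S. pauli_mat (s u) $ \<sigma> u $ \<tau> u)"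
      using assms I by (intro prod.mono_neutral_left) auto
    with True assms show ?thesis
      by (auto simp: pstr_def tensor_def)
  next
    case False
    then obtain u where u: "u \<notin> supp s" "\<sigma> u \<noteq> \<tau> u"
      by blast
    then have "u \<in> S \<Longrightarrow> (\<Prod>u\<in>S. pauli_mat (s u) $ \<sigma> u $ \<tau> u) = 0"
      using assms(1) I by (intro prod_zero bexI[of _ u]) auto
    with u False show ?thesis
      by (auto simp: pstr_def tensor_def)
  qed
qed

lemma tensor_scale:
  assumes "finite S"
  shows "tensor S (\<lambda>u. \<chi> i j. c u * M u $ i $ j) = (\<Prod>u\<in>S. c u) *\<^sub>o tensor S M"
  by (auto simp: tensor_def op_scale_def fun_eq_iff prod.distrib)

lemma pstr_mult:
  assumes "finite (supp s)" "finite (supp t)"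
  shows "pstr s \<odot> pstr t = sphase s t *\<^sub>o pstr (s \<cdot> t)"
proof -
  let ?S = "supp s \<union> supp t"
  have S: "finite ?S"
    using assms by simp
  have "pstr s \<odot> pstr t = tensor ?S (\<lambda>u. \<chi> i j. pauli_phase (s u) (t u) * pauli_mat ((s \<cdot> t) u) $ i $ j)"
    using S by (simp add: pstr_eq_tensor[of ?S] tensor_mult pauli_mat_mult smult_def)
  also have "\<dots> = sphase s t *\<^sub>o pstr (s \<cdot> t)"
  proof -
    have "sphase s t = (\<Prod>u\<in>?S. pauli_phase (s u) (t u))"
      by (rule sphase_eq_prod[OF S]) blast
    then show ?thesis
      by (simp only: tensor_scale[OF S] pstr_eq_tensor[OF S supp_smult])
  qed
  finally show ?thesis .
qed

lemma pstr_adj: "op_adj (pstr s) = pstr s"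
  by (auto simp: op_adj_def pstr_def tensor_def fun_eq_iff pauli_mat_hermitian)

lemma pstr_sid: "pstr sid = op_id"
  by (auto simp: pstr_def tensor_def op_id_def fun_eq_iff)

text \<open>The trace factorises over the sites, and X, Y, Z are traceless. Every later extraction
  of a coefficient rests on this.\<close>

lemma op_trace_pstr:
  assumes "finite S" "supp s \<subseteq> S"
  shows "op_trace S (pstr s) = (if s = sid then 2 ^ card S else 0)"
proof (cases "s = sid")
  case True
  then show ?thesis
    using assms pstr_eq_tensor[OF assms]
    by (simp add: op_trace_tensor trace_pauli_mat) (simp add: sid_def)
next
  case False
  then obtain u where "s u \<noteq> PI"
    by (auto simp: sid_def fun_eq_iff)
  with assms have "(\<Prod>u\<in>S. if s u = PI then 2 else 0 :: complex) = 0"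
    by (intro prod_zero) (auto simp: supp_def)
  with False show ?thesis
    using assms by (simp add: pstr_eq_tensor[OF assms] op_trace_tensor trace_pauli_mat)
qed

lemma row_finite_pstr: "finite (supp s) \<Longrightarrow> row_finite (pstr s)"
  by (simp add: pstr_def row_finite_tensor)

section \<open>Local operators as coefficient functions\<close>

text \<open>The second condition excludes strings of infinite support, for which the product in
  \<open>tensor\<close> degenerates to 1 and \<open>pstr\<close> is no product of Pauli
  matrices.\<close>

definition fin :: "('d string \<Rightarrow> complex) \<Rightarrow> bool" where
  "fin f \<longleftrightarrow> finite {s. f s \<noteq> 0} \<and> (\<forall>s. f s \<noteq> 0 \<longrightarrow> finite (supp s))"

definition lin :: "('d string \<Rightarrow> complex) \<Rightarrow> 'd oper" where
  "lin f = (\<lambda>\<sigma> \<tau>. \<Sum>s | f s \<noteq> 0. f s * pstr s \<sigma> \<tau>)"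

definition fsupp :: "('d string \<Rightarrow> complex) \<Rightarrow> 'd site set" where
  "fsupp f = (\<Union>s\<in>{s. f s \<noteq> 0}. supp s)"

lemma finite_fsupp: "fin f \<Longrightarrow> finite (fsupp f)"
  by (auto simp: fin_def fsupp_def)

lemma lin_eq_sum:
  assumes "finite F" "{s. f s \<noteq> 0} \<subseteq> F"
  shows "lin f \<sigma> \<tau> = (\<Sum>s\<in>F. f s * pstr s \<sigma> \<tau>)"
  unfolding lin_def using assms by (intro sum.mono_neutral_left) auto

lemma sum_oper_apply: "(\<Sum>i\<in>I. A i :: 'd oper) \<sigma> \<tau> = (\<Sum>i\<in>I. A i \<sigma> \<tau>)"
  by (induction I rule: infinite_finite_induct) auto

lemma fin_scale: "fin f \<Longrightarrow> fin (\<lambda>s. c * f s)"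
  unfolding fin_def by (auto elim: rev_finite_subset)

lemma fin_sum:
  assumes "\<And>i. i \<in> I \<Longrightarrow> fin (f i)"
  shows "fin (\<lambda>s. \<Sum>i\<in>I. f i s)"
proof (cases "finite I")
  case True
  have sub: "\<exists>i\<in>I. f i s \<noteq> 0" if "(\<Sum>i\<in>I. f i s) \<noteq> 0" for s
    using that sum.neutral by meson
  have "finite (\<Union>i\<in>I. {s. f i s \<noteq> 0})"
    using True assms by (auto simp: fin_def)
  then have "finite {s. (\<Sum>i\<in>I. f i s) \<noteq> 0}"
    by (rule rev_finite_subset) (use sub in auto)
  then show ?thesis
    using sub assms unfolding fin_def by blast
qed (simp add: fin_def)

lemma fin_add:
  assumes "fin f" "fin g"
  shows "fin (\<lambda>s. f s + g s)"
proof -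
  have "finite ({s. f s \<noteq> 0} \<union> {s. g s \<noteq> 0})"
    using assms by (simp add: fin_def)
  then have "finite {s. f s + g s \<noteq> 0}"
    by (rule rev_finite_subset) auto
  moreover have "finite (supp s)" if "f s + g s \<noteq> 0" for s
    using that assms unfolding fin_def by (metis add.right_neutral)
  ultimately show ?thesis
    by (simp add: fin_def)
qed

lemma fin_single: "finite (supp s) \<Longrightarrow> fin (\<lambda>t. if t = s then c else 0)"
  by (auto simp: fin_def)

lemma lin_scale: "lin (\<lambda>s. c * f s) = c *\<^sub>o lin f"
proof (cases "c = 0")
  case True
  then show ?thesis
    by (simp add: lin_def op_scale_def)
next
  case False
  then show ?thesis
    by (simp add: lin_def op_scale_def sum_distrib_left mult.assoc)
qed

lemma lin_add:
  assumes "fin f" "fin g"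
  shows "lin (\<lambda>s. f s + g s) = lin f + lin g"
proof (intro ext)
  fix \<sigma> \<tau>
  let ?F = "{s. f s \<noteq> 0} \<union> {s. g s \<noteq> 0}"
  have F: "finite ?F"
    using assms by (simp add: fin_def)
  have "lin (\<lambda>s. f s + g s) \<sigma> \<tau> = (\<Sum>s\<in>?F. (f s + g s) * pstr s \<sigma> \<tau>)"
    by (rule lin_eq_sum[OF F]) auto
  moreover have "lin f \<sigma> \<tau> = (\<Sum>s\<in>?F. f s * pstr s \<sigma> \<tau>)"
    by (rule lin_eq_sum[OF F]) auto
  moreover have "lin g \<sigma> \<tau> = (\<Sum>s\<in>?F. g s * pstr s \<sigma> \<tau>)"
    by (rule lin_eq_sum[OF F]) auto
  ultimately show "lin (\<lambda>s. f s + g s) \<sigma> \<tau> = (lin f + lin g) \<sigma> \<tau>"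
    by (simp add: distrib_right sum.distrib)
qed

lemma lin_diff:
  assumes "fin f" "fin g"
  shows "lin (\<lambda>s. f s - g s) = lin f - lin g"
proof -
  have "lin (\<lambda>s. f s + - 1 * g s) = lin f + (- 1) *\<^sub>o lin g"
    using lin_add[OF assms(1) fin_scale[OF assms(2), of "-1"]] unfolding lin_scale .
  then show ?thesis
    by (simp add: op_scale_def fun_eq_iff)
qed

lemma lin_zero: "lin (\<lambda>s. 0) = 0"
  by (simp add: lin_def fun_eq_iff)

lemma lin_sum:
  assumes "\<And>i. i \<in> I \<Longrightarrow> fin (f i)"
  shows "lin (\<lambda>s. \<Sum>i\<in>I. f i s) = (\<Sum>i\<in>I. lin (f i))"
  using assms
proof (induction I rule: infinite_finite_induct)
  case (insert x F)
  then show ?case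
    by (simp add: lin_add fin_sum)
qed (simp_all add: lin_zero)

lemma lin_single: "lin (\<lambda>t. if t = s then c else 0) = c *\<^sub>o pstr s"
proof (intro ext)
  show "lin (\<lambda>t. if t = s then c else 0) \<sigma> \<tau> = (c *\<^sub>o pstr s) \<sigma> \<tau>" for \<sigma> \<tau>
    by (subst lin_eq_sum[of "{s}"]) (auto simp: op_scale_def)
qed

text \<open>\<open>op_mult\<close> sums over the nonzero entries in a row of the left factor, and
  this set differs from string to string; the finite union of these sets serves for all of
  them.\<close>

lemma lin_mult_left:
  assumes "fin f"
  shows "lin f \<odot> B = (\<Sum>s | f s \<noteq> 0. f s *\<^sub>o (pstr s \<odot> B))"
proof (intro ext)
  fix \<sigma> \<tau>
  let ?F = "{s. f s \<noteq> 0}"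
  let ?R = "\<Union>s\<in>?F. {\<rho>. pstr s \<sigma> \<rho> \<noteq> 0}"
  have R: "finite ?R"
    using assms row_finite_pstr unfolding fin_def row_finite_def by blast
  have "lin f \<sigma> \<rho> = 0" if "\<rho> \<notin> ?R" for \<rho>
    unfolding lin_def using that by (intro sum.neutral) auto
  then have "(lin f \<odot> B) \<sigma> \<tau> = (\<Sum>\<rho>\<in>?R. lin f \<sigma> \<rho> * B \<rho> \<tau>)"
    by (intro op_mult_eq_sum[OF R]) blast
  also have "\<dots> = (\<Sum>s\<in>?F. f s * (\<Sum>\<rho>\<in>?R. pstr s \<sigma> \<rho> * B \<rho> \<tau>))"
    unfolding lin_def sum_distrib_right sum_distrib_left
    by (subst sum.swap) (simp add: mult.assoc)
  also have "\<dots> = (\<Sum>s\<in>?F. f s * (pstr s \<odot> B) \<sigma> \<tau>)"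
    by (intro sum.cong refl arg_cong2[where f = "(*)"] op_mult_eq_sum[OF R, symmetric]) auto
  finally show "(lin f \<odot> B) \<sigma> \<tau> = (\<Sum>s | f s \<noteq> 0. f s *\<^sub>o (pstr s \<odot> B)) \<sigma> \<tau>"
    by (simp add: sum_oper_apply op_scale_def)
qed

lemma lin_mult_right:
  shows "A \<odot> lin f = (\<Sum>s | f s \<noteq> 0. f s *\<^sub>o (A \<odot> pstr s))"
proof (intro ext)
  fix \<sigma> \<tau>
  let ?F = "{s. f s \<noteq> 0}"
  have "(A \<odot> lin f) \<sigma> \<tau> = (\<Sum>s\<in>?F. f s * (A \<odot> pstr s) \<sigma> \<tau>)"
    unfolding op_mult_def lin_def sum_distrib_left
    by (subst sum.swap) (simp add: mult_ac)
  then show "(A \<odot> lin f) \<sigma> \<tau> = (\<Sum>s | f s \<noteq> 0. f s *\<^sub>o (A \<odot> pstr s)) \<sigma> \<tau>"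
    by (simp add: sum_oper_apply op_scale_def)
qed

text \<open>Multiplication by a fixed string is an involution on strings, so a product with
  \<open>pstr e\<close> permutes the coefficients up to phases.\<close>

lemma translate_bij_betw:
  "bij_betw ((\<cdot>) e) {t. f (e \<cdot> t) \<noteq> (0::complex)} {s. f s \<noteq> 0}"
  by (rule bij_betwI[where g = "(\<cdot>) e"]) auto

lemma fin_translate:
  assumes "fin f" "finite (supp e)"
  shows "fin (\<lambda>t. c t * f (e \<cdot> t))"
proof -
  have "finite {t. f (e \<cdot> t) \<noteq> 0}"
    using assms bij_betw_finite[OF translate_bij_betw[of e f]] by (simp add: fin_def)
  then have "finite {t. c t * f (e \<cdot> t) \<noteq> 0}"
    by (rule rev_finite_subset) auto
  then show ?thesis
    using assms by (auto simp: fin_def finite_supp_smult_iff)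
qed

lemma lin_translate:
  assumes "fin f" "finite (supp e)"
  shows "lin (\<lambda>t. c t * f (e \<cdot> t)) = (\<Sum>s | f s \<noteq> 0. f s *\<^sub>o (c (e \<cdot> s) *\<^sub>o pstr (e \<cdot> s)))"
proof (intro ext)
  fix \<sigma> \<tau>
  have fin: "finite {t. f (e \<cdot> t) \<noteq> 0}"
    using assms bij_betw_finite[OF translate_bij_betw[of e f]] by (simp add: fin_def)
  have "lin (\<lambda>t. c t * f (e \<cdot> t)) \<sigma> \<tau> = (\<Sum>t | f (e \<cdot> t) \<noteq> 0. c t * f (e \<cdot> t) * pstr t \<sigma> \<tau>)"
    by (rule lin_eq_sum[OF fin]) auto
  also have "\<dots> = (\<Sum>t | f (e \<cdot> t) \<noteq> 0. f (e \<cdot> t) * (c (e \<cdot> (e \<cdot> t)) * pstr (e \<cdot> (e \<cdot> t)) \<sigma> \<tau>))"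
    by (simp add: mult_ac)
  also have "\<dots> = (\<Sum>s | f s \<noteq> 0. f s * (c (e \<cdot> s) * pstr (e \<cdot> s) \<sigma> \<tau>))"
    by (rule sum.reindex_bij_betw[OF translate_bij_betw])
  finally show "lin (\<lambda>t. c t * f (e \<cdot> t)) \<sigma> \<tau>
      = (\<Sum>s | f s \<noteq> 0. f s *\<^sub>o (c (e \<cdot> s) *\<^sub>o pstr (e \<cdot> s))) \<sigma> \<tau>"
    by (simp add: sum_oper_apply op_scale_def)
qed

lemma pstr_mult_lin:
  assumes "fin f" "finite (supp e)"
  shows "pstr e \<odot> lin f = lin (\<lambda>t. sphase e (e \<cdot> t) * f (e \<cdot> t))"
proof -
  have "pstr e \<odot> lin f = (\<Sum>s | f s \<noteq> 0. f s *\<^sub>o (sphase e s *\<^sub>o pstr (e \<cdot> s)))"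
    unfolding lin_mult_right
    using assms by (intro sum.cong refl) (simp add: pstr_mult fin_def)
  then show ?thesis
    by (simp add: lin_translate[OF assms])
qed

lemma lin_mult_pstr:
  assumes "fin f" "finite (supp e)"
  shows "lin f \<odot> pstr e = lin (\<lambda>t. sphase (e \<cdot> t) e * f (e \<cdot> t))"
proof -
  have "lin f \<odot> pstr e = (\<Sum>s | f s \<noteq> 0. f s *\<^sub>o (sphase s e *\<^sub>o pstr (e \<cdot> s)))"
    unfolding lin_mult_left[OF assms(1)]
    using assms by (intro sum.cong refl) (simp add: pstr_mult fin_def smult_commute)
  then show ?thesis
    by (simp add: lin_translate[OF assms])
qed

lemma op_trace_lin:
  assumes "fin f" "finite S" "fsupp f \<subseteq> S"
  shows "op_trace S (lin f) = f sid * 2 ^ card S"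
proof -
  have "op_trace S (lin f) = (\<Sum>s | f s \<noteq> 0. f s * op_trace S (pstr s))"
    unfolding op_trace_def lin_def sum_distrib_left by (rule sum.swap)
  also have "\<dots> = (\<Sum>s | f s \<noteq> 0. f s * (if s = sid then 2 ^ card S else 0))"
    using assms by (intro sum.cong refl arg_cong2[where f = "(*)"] op_trace_pstr)
      (auto simp: fsupp_def)
  also have "\<dots> = f sid * 2 ^ card S"
  proof (cases "f sid = 0")
    case True
    then have "\<And>s. f s \<noteq> 0 \<Longrightarrow> s \<noteq> sid"
      by auto
    then show ?thesis
      using True by (simp add: sum.neutral)
  next
    case False
    have "(\<Sum>s | f s \<noteq> 0. f s * (if s = sid then 2 ^ card S else 0))
        = (\<Sum>s\<in>{s. f s \<noteq> 0}. if s = sid then f sid * 2 ^ card S else 0)"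
      by (intro sum.cong) auto
    with False assms(1) show ?thesis
      by (simp add: fin_def)
  qed
  finally show ?thesis .
qed

lemma fsupp_translate: "fsupp (\<lambda>t. c t * f (e \<cdot> t)) \<subseteq> supp e \<union> fsupp f"
proof
  fix u assume "u \<in> fsupp (\<lambda>t. c t * f (e \<cdot> t))"
  then obtain t where t: "f (e \<cdot> t) \<noteq> 0" "u \<in> supp t"
    by (auto simp: fsupp_def)
  have "supp t \<subseteq> supp e \<union> supp (e \<cdot> t)"
    using supp_smult[of e "e \<cdot> t"] by simp
  with t show "u \<in> supp e \<union> fsupp f"
    by (auto simp: fsupp_def)
qed

text \<open>A product of two strings is a multiple of the identity only if they coincide, and then
  its phase is 1; hence the trace isolates one coefficient.\<close>

lemma op_trace_pstr_mult_lin: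
  assumes "fin f" "finite S" "fsupp f \<subseteq> S" "supp s \<subseteq> S"
  shows "op_trace S (pstr s \<odot> lin f) = f s * 2 ^ card S"
proof -
  have s: "finite (supp s)"
    using assms finite_subset by blast
  have "fsupp (\<lambda>t. sphase s (s \<cdot> t) * f (s \<cdot> t)) \<subseteq> S"
    using fsupp_translate[of "\<lambda>t. sphase s (s \<cdot> t)" f s] assms by blast
  then show ?thesis
    by (simp add: pstr_mult_lin[OF assms(1) s] op_trace_lin[OF fin_translate[OF assms(1) s] assms(2)])
qed

text \<open>Each coefficient is a normalised trace of the operator. This uniqueness is what pins
  down minimal supports.\<close>

lemma lin_inject:
  assumes "fin f" "fin g" "lin f = lin g"
  shows "f = g"
proof
  fix s
  show "f s = g s"
  proof (cases "finite (supp s)")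
    case True
    let ?S = "supp s \<union> fsupp f \<union> fsupp g"
    have S: "finite ?S"
      using assms True by (simp add: finite_fsupp)
    have "f s * 2 ^ card ?S = op_trace ?S (pstr s \<odot> lin f)"
      using S assms by (subst op_trace_pstr_mult_lin) auto
    also have "\<dots> = g s * 2 ^ card ?S"
      unfolding assms(3) using S assms by (subst op_trace_pstr_mult_lin) auto
    finally show ?thesis
      by simp
  next
    case False
    then show ?thesis
      using assms unfolding fin_def by metis
  qed
qed

lemma pstr_inj_on: "inj_on pstr {s. finite (supp s)}"
proof
  fix s t :: "'a string"
  assume "s \<in> {s. finite (supp s)}" "t \<in> {s. finite (supp s)}" and eq: "pstr s = pstr t"
  then have "(\<lambda>r. if r = s then 1 else 0 :: complex) = (\<lambda>r. if r = t then 1 else 0)"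
    by (intro lin_inject fin_single) (simp_all only: lin_single mem_Collect_eq)
  then show "s = t"
    by (metis one_neq_zero)
qed

section \<open>Supports, the state at infinite temperature and the inner product\<close>

lemma pauli_products_eq:
  assumes "finite S"
  shows "pauli_products S = pstr ` {s. supp s \<subseteq> S}"
proof (intro equalityI subsetI)
  fix P assume "P \<in> pauli_products S"
  then obtain T M where P: "P = tensor T M" and T: "T \<subseteq> S"
    and M: "\<And>u. u \<in> T \<Longrightarrow> M u \<in> {pauli_X, pauli_Y, pauli_Z}"
    by (auto simp: pauli_products_def)
  have "\<exists>a. a \<noteq> PI \<and> M u = pauli_mat a" if "u \<in> T" for u
    using M[OF that] by (metis insertE pauli.distinct(1,3,5) pauli_mat.simps(2-4) singletonD)
  then obtain s' where s': "\<And>u. u \<in> T \<Longrightarrow> s' u \<noteq> PI \<and> M u = pauli_mat (s' u)"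
    by metis
  define s where "s = (\<lambda>u. if u \<in> T then s' u else PI)"
  have supp: "supp s = T"
    using s' by (auto simp: supp_def s_def)
  then have "pstr s = P"
    unfolding pstr_def P using s' by (auto simp: tensor_def s_def fun_eq_iff)
  with supp T show "P \<in> pstr ` {s. supp s \<subseteq> S}"
    by auto
next
  fix P assume "P \<in> pstr ` {s. supp s \<subseteq> S}"
  then obtain s where s: "P = pstr s" "supp s \<subseteq> S"
    by auto
  moreover have "pauli_mat (s u) \<in> {pauli_X, pauli_Y, pauli_Z}" if "u \<in> supp s" for u
    using that by (cases "s u") (auto simp: supp_def)
  ultimately show "P \<in> pauli_products S"
    unfolding pauli_products_def pstr_def using assms finite_subset by blast
qed

lemma fsupp_sum: "fsupp (\<lambda>s. \<Sum>i\<in>I. f i s) \<subseteq> (\<Union>i\<in>I. fsupp (f i))"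
proof
  fix u assume "u \<in> fsupp (\<lambda>s. \<Sum>i\<in>I. f i s)"
  then obtain s where "(\<Sum>i\<in>I. f i s) \<noteq> 0" "u \<in> supp s"
    by (auto simp: fsupp_def)
  moreover from this obtain i where "i \<in> I" "f i s \<noteq> 0"
    using sum.neutral by meson
  ultimately show "u \<in> (\<Union>i\<in>I. fsupp (f i))"
    by (auto simp: fsupp_def)
qed

lemma local_on_imp_lin:
  assumes "finite S" "local_on S A"
  obtains f where "fin f" "fsupp f \<subseteq> S" "A = lin f"
proof -
  obtain F c where F: "finite F" "F \<subseteq> pauli_products S" and A: "A = (\<Sum>P\<in>F. c P *\<^sub>o P)"
    using assms(2) by (auto simp: local_on_def)
  have "\<forall>P\<in>F. \<exists>s. supp s \<subseteq> S \<and> P = pstr s"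
    using F pauli_products_eq[OF assms(1)] by auto
  then obtain s where s: "\<And>P. P \<in> F \<Longrightarrow> supp (s P) \<subseteq> S \<and> P = pstr (s P)"
    by metis
  define f where "f = (\<lambda>t. \<Sum>P\<in>F. if t = s P then c P else 0)"
  have fin: "fin (\<lambda>t. if t = s P then c P else 0)" if "P \<in> F" for P
    using s[OF that] assms(1) finite_subset by (intro fin_single) blast
  show thesis
  proof
    show "fin f"
      unfolding f_def by (rule fin_sum) (rule fin)
    have "fsupp (\<lambda>t. if t = s P then c P else 0) \<subseteq> S" if "P \<in> F" for P
      using s[OF that] by (auto simp: fsupp_def)
    then show "fsupp f \<subseteq> S"
      unfolding f_def using fsupp_sum[of "\<lambda>P t. if t = s P then c P else 0" F] by blast
    have "lin f = (\<Sum>P\<in>F. c P *\<^sub>o pstr (s P))"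
      unfolding f_def using fin by (simp add: lin_sum lin_single)
    then show "A = lin f"
      unfolding A using s by (simp cong: sum.cong)
  qed
qed

lemma lin_local_on:
  assumes "fin f" "finite S" "fsupp f \<subseteq> S"
  shows "local_on S (lin f)"
proof -
  let ?F = "{s. f s \<noteq> 0}"
  \<comment> \<open>\<open>local_on\<close> indexes the coefficients by operators, so the string has
    to be recovered from its operator.\<close>
  define g where "g = the_inv_into ?F pstr"
  have inj: "inj_on pstr ?F"
    using assms(1) by (intro inj_on_subset[OF pstr_inj_on]) (auto simp: fin_def)
  have "lin f = (\<Sum>s\<in>?F. f s *\<^sub>o pstr s)"
    by (simp add: lin_def fun_eq_iff sum_oper_apply op_scale_def)
  also have "\<dots> = (\<Sum>P\<in>pstr ` ?F. f (g P) *\<^sub>o P)"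
    using inj by (simp add: sum.reindex g_def the_inv_into_f_f)
  finally have "lin f = (\<Sum>P\<in>pstr ` ?F. f (g P) *\<^sub>o P)" .
  moreover have "finite (pstr ` ?F)" "pstr ` ?F \<subseteq> pauli_products S"
    using assms pauli_products_eq[of S] by (auto simp: fin_def fsupp_def)
  ultimately show ?thesis
    unfolding local_on_def by (intro exI[of _ "pstr ` ?F"] exI[of _ "\<lambda>P. f (g P)"]) simp
qed

text \<open>Any region on which the operator is local yields a coefficient function, which must be
  \<open>f\<close> itself; hence the region contains \<open>fsupp f\<close>.\<close>

lemma op_supp_lin:
  assumes "fin f"
  shows "op_supp (lin f) = fsupp f"
proof (intro equalityI)
  show "op_supp (lin f) \<subseteq> fsupp f"
    unfolding op_supp_def using lin_local_on[OF assms finite_fsupp] assms finite_fsupp by blast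
  show "fsupp f \<subseteq> op_supp (lin f)"
    unfolding op_supp_def
  proof (rule Inter_greatest)
    fix S assume "S \<in> {S. finite S \<and> local_on S (lin f)}"
    then obtain g where "fin g" "fsupp g \<subseteq> S" "lin f = lin g"
      using local_on_imp_lin by blast
    then show "fsupp f \<subseteq> S"
      using lin_inject[OF assms] by blast
  qed
qed

text \<open>The dimension \<open>2 ^ card S\<close> cancels against the trace of the identity, so
  all admissible regions agree; the instance \<open>fsupp f\<close> shows that the described value
  is unique.\<close>

lemma rho_inf_lin:
  assumes "fin f"
  shows "rho_inf (lin f) = f sid"
  unfolding rho_inf_def op_supp_lin[OF assms]
proof (rule the_equality)
  have *: "op_trace S (lin f) / op_trace S op_id = f sid" if "finite S" "fsupp f \<subseteq> S" for S
    using that assms by (simp add: op_trace_lin op_trace_pstr flip: pstr_sid)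
  show "\<forall>S. finite S \<and> fsupp f \<subseteq> S \<longrightarrow> f sid = op_trace S (lin f) / op_trace S op_id"
    using * by simp
  fix z assume "\<forall>S. finite S \<and> fsupp f \<subseteq> S \<longrightarrow> z = op_trace S (lin f) / op_trace S op_id"
  then show "z = f sid"
    using *[of "fsupp f"] finite_fsupp[OF assms] by auto
qed

definition ip :: "('d string \<Rightarrow> complex) \<Rightarrow> ('d string \<Rightarrow> complex) \<Rightarrow> complex" where
  "ip f g = (\<Sum>s | f s \<noteq> 0. cnj (f s) * g s)"

lemma lin_adj: "op_adj (lin f) = lin (\<lambda>s. cnj (f s))"
proof -
  have "cnj (pstr s \<tau> \<sigma>) = pstr s \<sigma> \<tau>" for s :: "'a string" and \<sigma> \<tau>
    by (metis op_adj_def pstr_adj)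
  then show ?thesis
    by (simp add: lin_def op_adj_def)
qed

text \<open>The inner product is the coefficient of the identity in the product, to which a string
  of \<open>f\<close> contributes only together with the same string of \<open>g\<close>.\<close>

lemma op_inner_lin:
  assumes "fin f" "fin g"
  shows "op_inner (lin f) (lin g) = ip f g"
proof -
  let ?F = "{s. f s \<noteq> 0}"
  define h where "h = (\<lambda>t. \<Sum>s\<in>?F. cnj (f s) * (sphase s (s \<cdot> t) * g (s \<cdot> t)))"
  have fin: "fin (\<lambda>t. cnj (f s) * (sphase s (s \<cdot> t) * g (s \<cdot> t)))" if "s \<in> ?F" for s
    using assms that by (intro fin_scale fin_translate) (auto simp: fin_def)
  have "fin (\<lambda>s. cnj (f s))"
    using assms(1) by (simp add: fin_def)
  then have "op_adj (lin f) \<odot> lin g = (\<Sum>s\<in>?F. cnj (f s) *\<^sub>o (pstr s \<odot> lin g))"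
    by (simp add: lin_adj lin_mult_left)
  also have "\<dots> = (\<Sum>s\<in>?F. cnj (f s) *\<^sub>o lin (\<lambda>t. sphase s (s \<cdot> t) * g (s \<cdot> t)))"
    using assms by (intro sum.cong refl) (auto simp: fin_def pstr_mult_lin)
  also have "\<dots> = lin h"
    unfolding h_def using fin by (subst lin_sum) (auto simp: lin_scale)
  finally have "op_inner (lin f) (lin g) = h sid"
    unfolding op_inner_def h_def by (simp only: rho_inf_lin[OF fin_sum[OF fin]])
  then show ?thesis
    by (simp add: h_def ip_def)
qed

section \<open>The Hamiltonian acting on coefficients\<close>

text \<open>The coefficients of the commutator of \<open>pstr e\<close> with \<open>lin f\<close>:
  the string \<open>t\<close> can arise only from \<open>e \<cdot> t\<close>.\<close>

definition comm :: "'d string \<Rightarrow> ('d string \<Rightarrow> complex) \<Rightarrow> 'd string \<Rightarrow> complex" where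
  "comm e f t = (sphase e (e \<cdot> t) - sphase (e \<cdot> t) e) * f (e \<cdot> t)"

lemma fin_comm: "fin f \<Longrightarrow> finite (supp e) \<Longrightarrow> fin (comm e f)"
  unfolding comm_def by (rule fin_translate)

lemma comm_nonzeroD:
  assumes "comm e f t \<noteq> 0"
  shows "f (e \<cdot> t) \<noteq> 0" "supp e \<inter> supp (e \<cdot> t) \<noteq> {}" "supp e \<inter> fsupp f \<noteq> {}"
proof -
  show f: "f (e \<cdot> t) \<noteq> 0"
    using assms by (auto simp: comm_def)
  show s: "supp e \<inter> supp (e \<cdot> t) \<noteq> {}"
  proof
    assume "supp e \<inter> supp (e \<cdot> t) = {}"
    then have "sphase e (e \<cdot> t) = 1" "sphase (e \<cdot> t) e = 1"
      by (auto intro!: sphase_disjoint)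
    with assms show False
      by (simp add: comm_def)
  qed
  show "supp e \<inter> fsupp f \<noteq> {}"
    using f s by (auto simp: fsupp_def)
qed

lemma op_commutator_pstr_lin:
  assumes "fin f" "finite (supp e)"
  shows "op_commutator (pstr e) (lin f) = lin (comm e f)"
proof -
  have "op_commutator (pstr e) (lin f)
      = lin (\<lambda>t. sphase e (e \<cdot> t) * f (e \<cdot> t) - sphase (e \<cdot> t) e * f (e \<cdot> t))"
    unfolding op_commutator_def pstr_mult_lin[OF assms] lin_mult_pstr[OF assms]
    by (rule lin_diff[symmetric]) (rule fin_translate[OF assms])+
  also have "(\<lambda>t. sphase e (e \<cdot> t) * f (e \<cdot> t) - sphase (e \<cdot> t) e * f (e \<cdot> t)) = comm e f"
    by (simp add: comm_def fun_eq_iff left_diff_distrib)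
  finally show ?thesis .
qed

lemma op_commutator_lin:
  assumes "fin b" "fin f"
  shows "op_commutator (lin b) (lin f) = (\<Sum>s | b s \<noteq> 0. b s *\<^sub>o lin (comm s f))"
proof -
  have "op_commutator (lin b) (lin f) = (\<Sum>s | b s \<noteq> 0. b s *\<^sub>o (pstr s \<odot> lin f))
      - (\<Sum>s | b s \<noteq> 0. b s *\<^sub>o (lin f \<odot> pstr s))"
    unfolding op_commutator_def lin_mult_left[OF assms(1)] lin_mult_right[of "lin f"] ..
  also have "\<dots> = (\<Sum>s | b s \<noteq> 0. b s *\<^sub>o op_commutator (pstr s) (lin f))"
    by (simp add: op_commutator_def fun_eq_iff sum_oper_apply op_scale_def right_diff_distrib
        flip: sum_subtractf)
  also have "\<dots> = (\<Sum>s | b s \<noteq> 0. b s *\<^sub>o lin (comm s f))"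
    using assms by (intro sum.cong refl) (simp add: op_commutator_pstr_lin fin_def)
  finally show ?thesis .
qed

lemma op_commutator_lin_disjoint:
  assumes "fin b" "fin f" "fsupp b \<inter> fsupp f = {}"
  shows "op_commutator (lin b) (lin f) = 0"
proof -
  have "b s *\<^sub>o lin (comm s f) = 0" if "b s \<noteq> 0" for s
  proof -
    have "comm s f = (\<lambda>_. 0)"
      using that assms(3) comm_nonzeroD(3)[of s f] by (fastforce simp: fsupp_def)
    then have "lin (comm s f) = 0"
      by (simp only: lin_zero)
    then show ?thesis
      by (simp add: op_scale_def fun_eq_iff)
  qed
  then show ?thesis
    unfolding op_commutator_lin[OF assms(1,2)] by (intro sum.neutral) auto
qed

lemma op_commutator_combination:
  assumes "finite A" "\<And>a. a \<in> A \<Longrightarrow> finite (supp (e a))" "fin f"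
  shows "op_commutator (\<Sum>a\<in>A. c a *\<^sub>o pstr (e a)) (lin f) = (\<Sum>a\<in>A. c a *\<^sub>o lin (comm (e a) f))"
proof -
  \<comment> \<open>The strings \<open>e a\<close> may coincide for different \<open>a\<close>, so
    their coefficients are collected first.\<close>
  define b where "b = (\<lambda>s. \<Sum>a\<in>A. if s = e a then c a else 0)"
  have fin: "fin (\<lambda>s. if s = e a then c a else 0)" if "a \<in> A" for a
    using assms(2)[OF that] by (rule fin_single)
  have b: "fin b" "lin b = (\<Sum>a\<in>A. c a *\<^sub>o pstr (e a))"
    unfolding b_def using fin by (auto simp: lin_sum lin_single intro: fin_sum)
  have "op_commutator (lin b) (lin f) = (\<Sum>s | b s \<noteq> 0. b s *\<^sub>o lin (comm s f))"
    using b(1) assms(3) by (rule op_commutator_lin)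
  also have "\<dots> = (\<Sum>s\<in>e ` A. b s *\<^sub>o lin (comm s f))"
  proof (rule sum.mono_neutral_left)
    show "{s. b s \<noteq> 0} \<subseteq> e ` A"
      unfolding b_def using sum.neutral by (smt (verit) image_eqI mem_Collect_eq subsetI)
  qed (use assms in \<open>auto simp: op_scale_def fun_eq_iff\<close>)
  also have "\<dots> = (\<Sum>s\<in>e ` A. \<Sum>a\<in>A. if s = e a then c a *\<^sub>o lin (comm (e a) f) else 0)"
  proof (intro sum.cong refl ext)
    fix s \<sigma> \<tau>
    show "(b s *\<^sub>o lin (comm s f)) \<sigma> \<tau>
        = (\<Sum>a\<in>A. if s = e a then c a *\<^sub>o lin (comm (e a) f) else 0) \<sigma> \<tau>"
      unfolding b_def sum_oper_apply
      by (auto simp: op_scale_def sum_distrib_right intro!: sum.cong)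
  qed
  also have "\<dots> = (\<Sum>a\<in>A. \<Sum>s\<in>e ` A. if s = e a then c a *\<^sub>o lin (comm (e a) f) else 0)"
    by (rule sum.swap)
  also have "\<dots> = (\<Sum>a\<in>A. c a *\<^sub>o lin (comm (e a) f))"
    using assms(1) by (intro sum.cong refl) (simp add: sum.delta')
  finally show ?thesis
    by (simp add: b(2))
qed

text \<open>The formal sum is made finite pointwise, by the terms that contribute to the string
  \<open>t\<close>, so that no support of \<open>f\<close> has to be mentioned.\<close>

definition hamsum :: "'i set \<Rightarrow> 'a set \<Rightarrow> ('a \<Rightarrow> complex) \<Rightarrow> ('i \<Rightarrow> 'a \<Rightarrow> 'd string) \<Rightarrow>
    ('d string \<Rightarrow> complex) \<Rightarrow> 'd string \<Rightarrow> complex" where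
  "hamsum I A c e f t =
     (\<Sum>a\<in>A. \<Sum>i | i \<in> I \<and> comm (e i a) f t \<noteq> 0. c a * comm (e i a) f t)"

text \<open>\<open>formal_commutator\<close> selects the terms by the support of \<open>h i\<close>,
  which is smaller than the union of the supports of its strings when coefficients vanish;
  \<open>hamsum\<close> selects them by nonzero commutators. Both selections lie in the finite set
  \<open>?E\<close>, and the surplus terms there commute with the operator or contribute
  zero.\<close>

lemma formal_commutator_lin:
  assumes A: "finite A" and e: "\<And>i a. i \<in> I \<Longrightarrow> a \<in> A \<Longrightarrow> finite (supp (e i a))"
    and h: "\<And>i. i \<in> I \<Longrightarrow> h i = (\<Sum>a\<in>A. c a *\<^sub>o pstr (e i a))"
    and f: "fin f"
    and E: "finite {i \<in> I. \<exists>a\<in>A. supp (e i a) \<inter> fsupp f \<noteq> {}}" (is "finite ?E")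
  shows "formal_commutator I h (lin f) = lin (hamsum I A c e f)" "fin (hamsum I A c e f)"
proof -
  define b where "b = (\<lambda>i s. \<Sum>a\<in>A. if s = e i a then c a else 0)"
  have b: "fin (b i)" "lin (b i) = h i" if "i \<in> I" for i
  proof -
    have fin: "fin (\<lambda>s. if s = e i a then c a else 0)" if "a \<in> A" for a
      using e[OF \<open>i \<in> I\<close> that] by (rule fin_single)
    show "fin (b i)"
      unfolding b_def by (rule fin_sum) (rule fin)
    show "lin (b i) = h i"
      unfolding b_def h[OF that] using fin by (simp add: lin_sum lin_single)
  qed
  have b_supp: "fsupp (b i) \<subseteq> (\<Union>a\<in>A. supp (e i a))" for i
  proof -
    have "fsupp (\<lambda>s. if s = e i a then c a else 0) \<subseteq> supp (e i a)" for a
      by (auto simp: fsupp_def)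
    then show ?thesis
      unfolding b_def using fsupp_sum[of "\<lambda>a s. if s = e i a then c a else 0" A] by blast
  qed
  have hs: "hamsum I A c e f = (\<lambda>t. \<Sum>a\<in>A. \<Sum>i\<in>?E. c a * comm (e i a) f t)"
  proof
    fix t
    show "hamsum I A c e f t = (\<Sum>a\<in>A. \<Sum>i\<in>?E. c a * comm (e i a) f t)"
      unfolding hamsum_def
      using comm_nonzeroD(3) by (intro sum.cong refl sum.mono_neutral_left E) (auto, blast)
  qed
  have fin: "fin (\<lambda>t. c a * comm (e i a) f t)" if "a \<in> A" "i \<in> ?E" for a i
    using that e f by (auto intro!: fin_scale fin_comm)
  have fin': "fin (\<lambda>t. \<Sum>i\<in>?E. c a * comm (e i a) f t)" if "a \<in> A" for a
    by (rule fin_sum) (use fin that in auto)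
  show "fin (hamsum I A c e f)"
    unfolding hs by (rule fin_sum) (rule fin')
  have "formal_commutator I h (lin f) = (\<Sum>i\<in>?E. op_commutator (h i) (lin f))"
    unfolding formal_commutator_def
  proof (rule sum.mono_neutral_left[OF E])
    have supp: "op_supp (h i) = fsupp (b i)" if "i \<in> I" for i
      using b[OF that] by (metis op_supp_lin)
    show "{i. i \<in> I \<and> op_supp (h i) \<inter> op_supp (lin f) \<noteq> {}} \<subseteq> ?E"
      using b_supp supp by (fastforce simp: op_supp_lin[OF f])
    have "op_commutator (h i) (lin f) = 0" if "i \<in> I" "op_supp (h i) \<inter> op_supp (lin f) = {}" for i
    proof -
      have "fsupp (b i) \<inter> fsupp f = {}"
        using that supp f by (simp add: op_supp_lin)
      then show ?thesis
        using op_commutator_lin_disjoint[of "b i" f] b[OF that(1)] f by simp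
    qed
    then show "\<forall>i\<in>?E - {i. i \<in> I \<and> op_supp (h i) \<inter> op_supp (lin f) \<noteq> {}}.
        op_commutator (h i) (lin f) = 0"
      by blast
  qed
  also have "\<dots> = (\<Sum>i\<in>?E. \<Sum>a\<in>A. c a *\<^sub>o lin (comm (e i a) f))"
    using h e by (intro sum.cong refl) (auto simp: op_commutator_combination[OF A _ f])
  also have "\<dots> = (\<Sum>a\<in>A. \<Sum>i\<in>?E. c a *\<^sub>o lin (comm (e i a) f))"
    by (rule sum.swap)
  also have "\<dots> = lin (hamsum I A c e f)"
  proof -
    have "lin (hamsum I A c e f) = (\<Sum>a\<in>A. lin (\<lambda>t. \<Sum>i\<in>?E. c a * comm (e i a) f t))"
      unfolding hs by (rule lin_sum) (rule fin')
    moreover have "(\<Sum>i\<in>?E. c a *\<^sub>o lin (comm (e i a) f))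
        = lin (\<lambda>t. \<Sum>i\<in>?E. c a * comm (e i a) f t)" if "a \<in> A" for a
      using that by (subst lin_sum[OF fin]) (auto simp only: lin_scale)
    ultimately show ?thesis
      by simp
  qed
  finally show "formal_commutator I h (lin f) = lin (hamsum I A c e f)" .
qed

section \<open>Terms of the Hamiltonian and bonds of the lattice\<close>

definition bondstr :: "'d site \<times> 'd site \<Rightarrow> pauli \<Rightarrow> 'd string" where
  "bondstr b a = (\<lambda>w. if w = fst b \<or> w = snd b then a else PI)"

definition sitestr :: "'d site \<Rightarrow> pauli \<Rightarrow> 'd string" where
  "sitestr u a = (\<lambda>w. if w = u then a else PI)"

lemma supp_bondstr [simp]: "a \<noteq> PI \<Longrightarrow> supp (bondstr b a) = {fst b, snd b}"
  by (auto simp: supp_def bondstr_def)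

lemma supp_sitestr [simp]: "a \<noteq> PI \<Longrightarrow> supp (sitestr u a) = {u}"
  by (auto simp: supp_def sitestr_def)

lemma at_site_eq_pstr: "a \<noteq> PI \<Longrightarrow> at_site (pauli_mat a) u = pstr (sitestr u a)"
  by (auto simp: at_site_def pstr_def tensor_def sitestr_def supp_def fun_eq_iff)

lemma at_site_mult:
  assumes "u \<noteq> v" "a \<noteq> PI"
  shows "at_site (pauli_mat a) u \<odot> at_site (pauli_mat a) v = pstr (bondstr (u, v) a)"
proof -
  have "sitestr u a \<cdot> sitestr v a = bondstr (u, v) a"
    using assms by (auto simp: smult_def sitestr_def bondstr_def fun_eq_iff)
  moreover have "sphase (sitestr u a) (sitestr v a) = 1"
    using assms by (intro sphase_disjoint) auto
  ultimately show ?thesis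
    using assms by (simp add: at_site_eq_pstr pstr_mult op_scale_def)
qed

definition coupling :: "real \<Rightarrow> real \<Rightarrow> real \<Rightarrow> pauli \<Rightarrow> real" where
  "coupling x y z = case_pauli 0 x y z"

lemma coupling_simps [simp]:
  "coupling x y z PX = x" "coupling x y z PY = y" "coupling x y z PZ = z"
  by (simp_all add: coupling_def)

abbreviation xyz :: "pauli set" where
  "xyz \<equiv> {PX, PY, PZ}"

lemma bond_term_eq:
  assumes "fst b \<noteq> snd b"
  shows "bond_term JX JY JZ b
    = (\<Sum>a\<in>xyz. complex_of_real (- coupling JX JY JZ a / 2) *\<^sub>o pstr (bondstr b a))"
proof -
  obtain u v where b: "b = (u, v)"
    by force
  show ?thesis
    using assms at_site_mult[of u v PX] at_site_mult[of u v PY] at_site_mult[of u v PZ]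
    by (simp add: b bond_term_def fun_eq_iff op_scale_def algebra_simps)
qed

lemma field_term_eq:
  "field_term hX hY hZ u
    = (\<Sum>a\<in>xyz. complex_of_real (- coupling hX hY hZ a) *\<^sub>o pstr (sitestr u a))"
  using at_site_eq_pstr[of PX u] at_site_eq_pstr[of PY u] at_site_eq_pstr[of PZ u]
  by (simp add: field_term_def fun_eq_iff op_scale_def algebra_simps)

definition up :: "('d::finite) site \<Rightarrow> 'd site \<Rightarrow> bool" where
  "up u v \<longleftrightarrow> (\<exists>k. v = u + axis k 1)"

text \<open>Its parity is the checkerboard colouring of the lattice; since it increases along
  \<open>up\<close>, it also rules out loops and reversed steps.\<close>

definition height :: "('d::finite) site \<Rightarrow> int" where
  "height u = (\<Sum>k\<in>UNIV. u $ k)"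

lemma height_up: "up u v \<Longrightarrow> height v = height u + 1"
  by (auto simp: up_def height_def sum.distrib axis_def)

text \<open>One nonzero integer coordinate already exhausts the sum. Euclidean distance 1 thereby
  becomes a unit step along an axis.\<close>

lemma sum_squares_eq_1:
  fixes w :: "int ^ 'd"
  assumes "(\<Sum>i\<in>UNIV. (w $ i)\<^sup>2) = 1"
  shows "\<exists>k. w = axis k 1 \<or> w = axis k (- 1)"
proof -
  obtain k where k: "w $ k \<noteq> 0"
    using assms by fastforce
  have "(\<Sum>i\<in>UNIV. (w $ i)\<^sup>2) = (w $ k)\<^sup>2 + (\<Sum>i\<in>UNIV - {k}. (w $ i)\<^sup>2)"
    by (rule sum.remove) auto
  moreover have "(w $ k)\<^sup>2 \<ge> 1"
    using k by (simp add: int_one_le_iff_zero_less)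
  moreover have "(\<Sum>i\<in>UNIV - {k}. (w $ i)\<^sup>2) \<ge> 0"
    by (simp add: sum_nonneg)
  ultimately have *: "(w $ k)\<^sup>2 = 1" "(\<Sum>i\<in>UNIV - {k}. (w $ i)\<^sup>2) = 0"
    using assms by linarith+
  from *(2) have "w $ i = 0" if "i \<noteq> k" for i
    using that by (subst (asm) sum_nonneg_eq_0_iff) auto
  moreover have "w $ k = 1 \<or> w $ k = - 1"
    using *(1) by (simp add: power2_eq_1_iff)
  ultimately show ?thesis
    by (intro exI[of _ k]) (auto simp: vec_eq_iff axis_def)
qed

lemma site_dist_eq_1_iff: "site_dist u v = 1 \<longleftrightarrow> up u v \<or> up v u"
proof -
  have "site_dist u v = sqrt (\<Sum>i\<in>UNIV. (real_of_int ((u - v) $ i))\<^sup>2)"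
    by (simp add: site_dist_def norm_vec_def L2_set_def)
  also have "\<dots> = sqrt (real_of_int (\<Sum>i\<in>UNIV. ((u - v) $ i)\<^sup>2))"
    by simp
  finally have eq: "site_dist u v = 1 \<longleftrightarrow> (\<Sum>i\<in>UNIV. ((u - v) $ i)\<^sup>2) = 1"
    by (simp only: real_sqrt_eq_1_iff of_int_eq_1_iff)
  have up: "up u v \<longleftrightarrow> (\<exists>k. u - v = axis k (- 1))" "up v u \<longleftrightarrow> (\<exists>k. u - v = axis k 1)"
  proof -
    have minus: "axis k (- 1) = - axis k (1::int)" for k :: 'a
      by (simp add: vec_eq_iff axis_def)
    show "up u v \<longleftrightarrow> (\<exists>k. u - v = axis k (- 1))"
    proof -
      have "v = u + a \<longleftrightarrow> u - v = - a" for a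
      proof
        assume "u - v = - a"
        then have "u - (u - v) = u - (- a)"
          by (rule arg_cong)
        then show "v = u + a"
          by simp
      qed simp
      then show ?thesis
        unfolding up_def minus by simp
    qed
    show "up v u \<longleftrightarrow> (\<exists>k. u - v = axis k 1)"
      unfolding up_def by (simp add: diff_eq_eq add.commute)
  qed
  show ?thesis
  proof
    assume "site_dist u v = 1"
    then show "up u v \<or> up v u"
      unfolding eq up using sum_squares_eq_1 by blast
  next
    assume "up u v \<or> up v u"
    then obtain k where k: "u - v = axis k 1 \<or> u - v = axis k (- 1)"
      unfolding up by blast
    have axis: "(\<Sum>i\<in>UNIV. (axis k c $ i)\<^sup>2) = c\<^sup>2" for c :: int
    proof -
      have "(\<Sum>i\<in>UNIV. (axis k c $ i)\<^sup>2) = (\<Sum>i\<in>UNIV. if i = k then c\<^sup>2 else 0)"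
        by (intro sum.cong refl) (simp add: axis_def)
      then show ?thesis
        by simp
    qed
    from k show "site_dist u v = 1"
      unfolding eq
    proof
      assume "u - v = axis k 1"
      then show "(\<Sum>i\<in>UNIV. ((u - v) $ i)\<^sup>2) = 1"
        using axis[of 1] by (simp only: one_power2)
    next
      assume "u - v = axis k (- 1)"
      then show "(\<Sum>i\<in>UNIV. ((u - v) $ i)\<^sup>2) = 1"
        using axis[of "- 1"] by (simp only: power2_minus one_power2)
    qed
  qed
qed

definition bonds :: "(('d::finite) site \<times> 'd site) set" where
  "bonds = {(u, v). site_dist u v = 1}"

lemma bonds_iff: "b \<in> bonds \<longleftrightarrow> up (fst b) (snd b) \<or> up (snd b) (fst b)"
  by (auto simp: bonds_def site_dist_eq_1_iff)

lemma bonds_irrefl: "b \<in> bonds \<Longrightarrow> fst b \<noteq> snd b"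
  using height_up by (fastforce simp: bonds_iff)

lemma finite_bonds_meeting:
  assumes "finite S"
  shows "finite {b \<in> bonds. {fst b, snd b} \<inter> S \<noteq> {}}"
proof (rule finite_subset)
  define N where "N u = range (\<lambda>k. u + axis k 1) \<union> range (\<lambda>k. u - axis k (1::int))" for u :: "'a site"
  show "finite ((SIGMA u:S. N u) \<union> (SIGMA u:S. N u)\<inverse>)"
    using assms by (auto simp: N_def)
  have N: "v \<in> N u \<and> u \<in> N v" if up: "up u v" for u v :: "'a site"
  proof -
    obtain k where k: "v = u + axis k 1"
      using up by (auto simp: up_def)
    then have "u = v - axis k 1"
      by simp
    with k show ?thesis
      unfolding N_def by blast
  qed
  show "{b \<in> bonds. {fst b, snd b} \<inter> S \<noteq> {}} \<subseteq> (SIGMA u:S. N u) \<union> (SIGMA u:S. N u)\<inverse>"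
  proof
    fix b assume b: "b \<in> {b \<in> bonds. {fst b, snd b} \<inter> S \<noteq> {}}"
    obtain u v where uv: "b = (u, v)"
      by force
    have "v \<in> N u" "u \<in> N v"
      using b N[of u v] N[of v u] by (auto simp: bonds_iff uv)
    then show "b \<in> (SIGMA u:S. N u) \<union> (SIGMA u:S. N u)\<inverse>"
      using b by (auto simp: uv)
  qed
qed

definition ham :: "(pauli \<Rightarrow> real) \<Rightarrow> (pauli \<Rightarrow> real) \<Rightarrow>
    (('d::finite) string \<Rightarrow> complex) \<Rightarrow> 'd string \<Rightarrow> complex" where
  "ham J h f t = hamsum bonds xyz (\<lambda>a. complex_of_real (- J a / 2)) bondstr f t
     + hamsum UNIV xyz (\<lambda>a. complex_of_real (- h a)) sitestr f t"

lemma ham_commutator_lin: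
  fixes JX JY JZ hX hY hZ :: real
  assumes "fin f"
  defines "J \<equiv> coupling JX JY JZ" and "h \<equiv> coupling hX hY hZ"
  shows "ham_commutator JX JY JZ hX hY hZ (lin f) = lin (ham J h f)" "fin (ham J h f)"
proof -
  have S: "finite (fsupp f)"
    using assms(1) by (rule finite_fsupp)
  have "finite {b \<in> bonds. \<exists>a\<in>xyz. supp (bondstr b a) \<inter> fsupp f \<noteq> {}}"
    by (rule finite_subset[OF _ finite_bonds_meeting[OF S]]) auto
  note 1 = formal_commutator_lin[where h = "bond_term JX JY JZ" and I = bonds
      and A = xyz and e = bondstr and c = "\<lambda>a. complex_of_real (- J a / 2)",
      OF _ _ _ assms(1) this]
  have 11: "formal_commutator bonds (bond_term JX JY JZ) (lin f)
      = lin (hamsum bonds xyz (\<lambda>a. complex_of_real (- J a / 2)) bondstr f)"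
    by (rule 1(1)) (auto simp: J_def bond_term_eq bonds_irrefl)
  have 12: "fin (hamsum bonds xyz (\<lambda>a. complex_of_real (- J a / 2)) bondstr f)"
    by (rule 1(2)) (auto simp: J_def bond_term_eq bonds_irrefl)
  have "finite {u \<in> UNIV. \<exists>a\<in>xyz. supp (sitestr u a) \<inter> fsupp f \<noteq> {}}"
    by (rule finite_subset[OF _ S]) auto
  note 2 = formal_commutator_lin[where h = "field_term hX hY hZ" and I = UNIV
      and A = xyz and e = sitestr and c = "\<lambda>a. complex_of_real (- h a)",
      OF _ _ _ assms(1) this]
  have 21: "formal_commutator UNIV (field_term hX hY hZ) (lin f)
      = lin (hamsum UNIV xyz (\<lambda>a. complex_of_real (- h a)) sitestr f)"
    by (rule 2(1)) (auto simp: h_def field_term_eq)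
  have 22: "fin (hamsum UNIV xyz (\<lambda>a. complex_of_real (- h a)) sitestr f)"
    by (rule 2(2)) (auto simp: h_def field_term_eq)
  have ham: "ham J h f = (\<lambda>t. hamsum bonds xyz (\<lambda>a. complex_of_real (- J a / 2)) bondstr f t
      + hamsum UNIV xyz (\<lambda>a. complex_of_real (- h a)) sitestr f t)"
    by (simp add: ham_def fun_eq_iff)
  show "ham_commutator JX JY JZ hX hY hZ (lin f) = lin (ham J h f)"
    unfolding ham lin_add[OF 12 22] ham_commutator_def bonds_def[symmetric] 11 21 ..
  show "fin (ham J h f)"
    unfolding ham using 12 22 by (rule fin_add)
qed

primrec kry :: "(pauli \<Rightarrow> real) \<Rightarrow> (pauli \<Rightarrow> real) \<Rightarrow> nat \<Rightarrow> ('d::finite) string \<Rightarrow> complex" where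
  "kry J h 0 = (\<lambda>t. if t = sitestr 0 PX then 1 else 0)"
| "kry J h (Suc n) = (\<lambda>t. \<i> * ham J h (kry J h n) t)"

lemma krylov_B_eq_lin:
  fixes JX JY JZ hX hY hZ :: real
  defines "J \<equiv> coupling JX JY JZ" and "h \<equiv> coupling hX hY hZ"
  shows "krylov_B (ham_commutator JX JY JZ hX hY hZ) (at_site pauli_X (0 :: 'd site)) n = lin (kry J h n)
    \<and> fin (kry J h n :: ('d::finite) string \<Rightarrow> complex)"
proof (induction n)
  case 0
  then show ?case
    using at_site_eq_pstr[of PX] by (simp add: lin_single fin_single op_scale_def)
next
  case (Suc n)
  note ham = ham_commutator_lin[OF conjunct2[OF Suc.IH], of JX JY JZ hX hY hZ, folded J_def h_def]
  show ?case
    using Suc ham(1) fin_scale[OF ham(2)] by (simp add: lin_scale)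
qed

section \<open>Gram--Schmidt\<close>

lemma ip_eq_sum:
  assumes "finite F" "{s. f s \<noteq> 0} \<inter> {s. g s \<noteq> 0} \<subseteq> F"
  shows "fin f \<Longrightarrow> ip f g = (\<Sum>s\<in>F. cnj (f s) * g s)"
proof -
  assume "fin f"
  then have "ip f g = (\<Sum>s\<in>{s. f s \<noteq> 0} \<inter> {s. g s \<noteq> 0}. cnj (f s) * g s)"
    unfolding ip_def fin_def by (intro sum.mono_neutral_right) auto
  also have "\<dots> = (\<Sum>s\<in>F. cnj (f s) * g s)"
    using assms by (intro sum.mono_neutral_left) auto
  finally show ?thesis .
qed

lemma ip_commute:
  assumes "fin f" "fin g"
  shows "cnj (ip f g) = ip g f"
proof -
  let ?F = "{s. f s \<noteq> 0}"
  have "ip g f = (\<Sum>s\<in>?F. cnj (g s) * f s)"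
    using assms by (intro ip_eq_sum) (auto simp: fin_def)
  then show ?thesis
    by (simp add: ip_def mult.commute)
qed

lemma ip_sum_right: "ip f (\<lambda>s. \<Sum>i\<in>I. c i * g i s) = (\<Sum>i\<in>I. c i * ip f (g i))"
  unfolding ip_def sum_distrib_left by (subst sum.swap) (simp add: mult_ac)

lemma ip_diff_right: "ip f (\<lambda>s. g s - h s) = ip f g - ip f h"
  by (simp add: ip_def right_diff_distrib sum_subtractf)

lemma ip_self: "ip f f = complex_of_real (\<Sum>s | f s \<noteq> 0. (cmod (f s))\<^sup>2)"
  by (simp add: ip_def complex_norm_square mult.commute flip: of_real_power)

lemma norm_le_ip_self:
  assumes "fin f"
  shows "(cmod (f t))\<^sup>2 \<le> Re (ip f f)"
proof (cases "f t = 0")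
  case True
  then show ?thesis
    by (simp add: ip_self sum_nonneg)
next
  case False
  with assms show ?thesis
    unfolding ip_self by (auto simp: fin_def intro!: member_le_sum)
qed

lemma ip_self_eq_0:
  assumes "fin f" "ip f f = 0"
  shows "f = (\<lambda>_. 0)"
proof
  fix t
  show "f t = 0"
    using norm_le_ip_self[OF assms(1), of t] assms(2) by simp
qed

definition spanned :: "(nat \<Rightarrow> 'd string \<Rightarrow> complex) \<Rightarrow> nat \<Rightarrow> ('d string \<Rightarrow> complex) \<Rightarrow> bool" where
  "spanned \<beta> n f \<longleftrightarrow> (\<exists>\<alpha>. f = (\<lambda>s. \<Sum>j<n. \<alpha> j * \<beta> j s))"

lemma spanned_mono:
  assumes "spanned \<beta> m f" "m \<le> n"
  shows "spanned \<beta> n f"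
proof -
  obtain \<alpha> where f: "f = (\<lambda>s. \<Sum>j<m. \<alpha> j * \<beta> j s)"
    using assms(1) by (auto simp: spanned_def)
  have "f = (\<lambda>s. \<Sum>j<n. (if j < m then \<alpha> j else 0) * \<beta> j s)"
  proof
    fix s
    show "f s = (\<Sum>j<n. (if j < m then \<alpha> j else 0) * \<beta> j s)"
      unfolding f using assms(2) by (intro sum.mono_neutral_cong_left) auto
  qed
  then show ?thesis
    unfolding spanned_def by (intro exI)
qed

lemma spanned_basis: "j < n \<Longrightarrow> spanned \<beta> n (\<beta> j)"
  unfolding spanned_def
  by (intro exI[of _ "\<lambda>i. if i = j then 1 else 0"])
    (simp add: if_distrib[of "\<lambda>x. x * _"] cong: if_cong)

lemma spanned_add:
  assumes "spanned \<beta> n f" "spanned \<beta> n g"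
  shows "spanned \<beta> n (\<lambda>s. f s + g s)"
proof -
  obtain a b where "f = (\<lambda>s. \<Sum>j<n. a j * \<beta> j s)" "g = (\<lambda>s. \<Sum>j<n. b j * \<beta> j s)"
    using assms by (auto simp: spanned_def)
  then show ?thesis
    unfolding spanned_def by (intro exI[of _ "\<lambda>j. a j + b j"]) (simp add: distrib_right sum.distrib)
qed

lemma spanned_scale:
  assumes "spanned \<beta> n f"
  shows "spanned \<beta> n (\<lambda>s. c * f s)"
proof -
  obtain a where "f = (\<lambda>s. \<Sum>j<n. a j * \<beta> j s)"
    using assms by (auto simp: spanned_def)
  then show ?thesis
    unfolding spanned_def by (intro exI[of _ "\<lambda>j. c * a j"]) (simp add: sum_distrib_left mult.assoc)
qed

lemma spanned_sum:
  assumes "finite I" "\<And>i. i \<in> I \<Longrightarrow> spanned \<beta> n (f i)"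
  shows "spanned \<beta> n (\<lambda>s. \<Sum>i\<in>I. c i * f i s)"
  using assms
proof (induction I rule: finite_induct)
  case empty
  then show ?case
    unfolding spanned_def by (intro exI[of _ "\<lambda>_. 0"]) simp
next
  case (insert x F)
  then show ?case
    by (simp add: spanned_add spanned_scale)
qed

lemma fin_spanned:
  assumes "\<And>n. fin (\<beta> n)" "spanned \<beta> n f"
  shows "fin f"
  using assms(2) unfolding spanned_def by (auto intro!: fin_sum fin_scale assms(1))

lemma ip_spanned_zero:
  assumes "\<And>j. j < n \<Longrightarrow> ip f (\<beta> j) = 0" "spanned \<beta> n g"
  shows "ip f g = 0"
  using assms(2) unfolding spanned_def by (auto simp: ip_sum_right assms(1))

text \<open>Since \<open>\<gamma> j\<close> differs from \<open>\<beta> j\<close> by earlier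
  \<beta>'s, strong induction makes \<open>f\<close> orthogonal to every \<open>\<beta> j\<close>,
  hence to itself. It is the operator that is unique, not its coefficients over the
  \<beta>'s.\<close>

lemma gram_schmidt_unique:
  assumes "\<And>j. j < n \<Longrightarrow> spanned \<beta> j (\<lambda>s. \<gamma> j s - \<beta> j s)"
    and "\<And>n. fin (\<beta> n)" "\<And>j. j < n \<Longrightarrow> fin (\<gamma> j)"
    and "spanned \<beta> n f" "\<And>j. j < n \<Longrightarrow> ip (\<gamma> j) f = 0"
  shows "f = (\<lambda>_. 0)"
proof -
  have f: "fin f"
    using assms(2,4) by (rule fin_spanned)
  have "ip f (\<beta> j) = 0" if "j < n" for j
    using that
  proof (induction j rule: less_induct)
    case (less j)
    have "ip f (\<gamma> j) = cnj (ip (\<gamma> j) f)"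
      using ip_commute[OF assms(3)[OF less.prems] f] by simp
    then have "ip f (\<gamma> j) = 0"
      using less.prems assms(5) by simp
    moreover have "ip f (\<lambda>s. \<gamma> j s - \<beta> j s) = 0"
    proof (rule ip_spanned_zero[OF _ assms(1)[OF less.prems]])
      fix i assume "i < j"
      then show "ip f (\<beta> i) = 0"
        using less.IH[of i] less.prems by simp
    qed
    ultimately show ?case
      by (simp add: ip_diff_right)
  qed
  then have "ip f f = 0"
    using assms(4) by (rule ip_spanned_zero)
  with f show ?thesis
    by (rule ip_self_eq_0)
qed

text \<open>Resolves the definite description: existence by projecting off the earlier \<gamma>'s,
  uniqueness by \<open>gram_schmidt_unique\<close>. Mutual orthogonality is carried through the
  induction because the projection formula relies on it.\<close>

lemma lanczos_C_eq:
  assumes B: "\<And>n. krylov_B L B0 n = lin (\<beta> n)" "\<And>n. fin (\<beta> n)"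
  shows "\<exists>\<gamma>. lanczos_C L B0 n = lin \<gamma> \<and> spanned \<beta> n (\<lambda>s. \<gamma> s - \<beta> n s)
    \<and> (\<forall>j<n. op_inner (lanczos_C L B0 n) (lanczos_C L B0 j) = 0)"
proof (induction n rule: less_induct)
  case (less n)
  then obtain \<gamma> where \<gamma>: "\<And>j. j < n \<Longrightarrow> lanczos_C L B0 j = lin (\<gamma> j)"
      "\<And>j. j < n \<Longrightarrow> spanned \<beta> j (\<lambda>s. \<gamma> j s - \<beta> j s)"
      "\<And>i j. j < n \<Longrightarrow> i < j \<Longrightarrow> op_inner (lanczos_C L B0 j) (lanczos_C L B0 i) = 0"
    by metis
  have fin: "fin f" if "spanned \<beta> j (\<lambda>s. f s - \<beta> j s)" for f j
  proof -
    have "fin (\<lambda>s. (f s - \<beta> j s) + \<beta> j s)"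
      by (intro fin_add fin_spanned[OF B(2) that] B(2))
    then show ?thesis
      by simp
  qed
  have fin\<gamma>: "fin (\<gamma> j)" if "j < n" for j
    using fin \<gamma>(2)[OF that] by blast
  have span\<gamma>: "spanned \<beta> n (\<gamma> j)" if "j < n" for j
    using spanned_add[OF spanned_mono[OF \<gamma>(2)[OF that], of n] spanned_basis[OF that]] that
    by simp
  let ?P = "\<lambda>C. (\<exists>\<alpha>. C = krylov_B L B0 n + (\<Sum>j<n. \<alpha> j *\<^sub>o krylov_B L B0 j)) \<and>
     (\<forall>j\<in>{..<n}. op_inner C (lanczos_C L B0 j) = 0)"
  \<comment> \<open>The definition has the new operator in the first, antilinear slot; conjugation
    moves it to the linear one.\<close>
  have P: "?P (lin f) \<longleftrightarrow> (\<forall>j<n. ip (\<gamma> j) f = 0)" if f: "spanned \<beta> n (\<lambda>s. f s - \<beta> n s)" for f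
  proof -
    obtain \<alpha> where \<alpha>: "(\<lambda>s. f s - \<beta> n s) = (\<lambda>s. \<Sum>j<n. \<alpha> j * \<beta> j s)"
      using f by (auto simp: spanned_def)
    have sum: "lin (\<lambda>s. \<Sum>j<n. \<alpha> j * \<beta> j s) = (\<Sum>j<n. \<alpha> j *\<^sub>o lin (\<beta> j))"
      by (subst lin_sum) (auto simp: lin_scale fin_scale B(2))
    have "lin f - lin (\<beta> n) = (\<Sum>j<n. \<alpha> j *\<^sub>o lin (\<beta> j))"
      using lin_diff[OF fin[OF f] B(2)] \<alpha> sum by metis
    then have "lin f = krylov_B L B0 n + (\<Sum>j<n. \<alpha> j *\<^sub>o krylov_B L B0 j)"
      by (simp add: B(1) diff_eq_eq add.commute)
    moreover have "op_inner (lin f) (lanczos_C L B0 j) = 0 \<longleftrightarrow> ip (\<gamma> j) f = 0" if "j < n" for j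
      using ip_commute[OF fin[OF f] fin\<gamma>[OF that]] op_inner_lin[OF fin[OF f] fin\<gamma>[OF that]]
      by (metis \<gamma>(1)[OF that] complex_cnj_zero_iff)
    ultimately show ?thesis
      by auto
  qed
  have ex: "\<exists>f. C = lin f \<and> spanned \<beta> n (\<lambda>s. f s - \<beta> n s)" if PC: "?P C" for C
  proof -
    obtain \<alpha> where C: "C = krylov_B L B0 n + (\<Sum>j<n. \<alpha> j *\<^sub>o krylov_B L B0 j)"
      using PC by blast
    define g where "g = (\<lambda>s. \<Sum>j<n. \<alpha> j * \<beta> j s)"
    have g: "spanned \<beta> n g"
      unfolding g_def spanned_def by blast
    have "lin g = (\<Sum>j<n. \<alpha> j *\<^sub>o lin (\<beta> j))"
      unfolding g_def by (subst lin_sum) (auto simp: lin_scale fin_scale B(2))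
    then have "C = lin (\<lambda>s. \<beta> n s + g s)"
      using lin_add[OF B(2) fin_spanned[OF B(2) g], of n] by (simp add: C B(1))
    then show ?thesis
      using g by (intro exI[of _ "\<lambda>s. \<beta> n s + g s"]) simp
  qed
  \<comment> \<open>If \<open>\<gamma> j\<close> vanishes, division by zero gives 0, and
    orthogonality to \<open>\<gamma> j\<close> is trivial.\<close>
  define c where "c j = ip (\<gamma> j) (\<beta> n) / ip (\<gamma> j) (\<gamma> j)" for j
  define f where "f = (\<lambda>s. \<beta> n s - (\<Sum>j<n. c j * \<gamma> j s))"
  have "spanned \<beta> n (\<lambda>s. - 1 * (\<Sum>j<n. c j * \<gamma> j s))"
    by (intro spanned_scale spanned_sum) (auto simp: span\<gamma>)
  then have f: "spanned \<beta> n (\<lambda>s. f s - \<beta> n s)"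
    by (simp add: f_def)
  have orth: "ip (\<gamma> j) (\<gamma> i) = 0" if "j < n" "i < n" "i \<noteq> j" for i j
  proof (cases "i < j")
    case True
    then show ?thesis
      using \<gamma>(3)[of j i] that by (simp add: \<gamma>(1) op_inner_lin fin\<gamma>)
  next
    case False
    then have "ip (\<gamma> i) (\<gamma> j) = 0"
      using \<gamma>(3)[of i j] that by (simp add: \<gamma>(1) op_inner_lin fin\<gamma>)
    then show ?thesis
      using ip_commute[of "\<gamma> i" "\<gamma> j"] that fin\<gamma> by simp
  qed
  have "ip (\<gamma> j) f = 0" if "j < n" for j
  proof -
    have "(\<Sum>i<n. c i * ip (\<gamma> j) (\<gamma> i)) = (\<Sum>i<n. if i = j then c j * ip (\<gamma> j) (\<gamma> j) else 0)"
      using that orth by (intro sum.cong) auto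
    also have "\<dots> = ip (\<gamma> j) (\<beta> n)"
      using that ip_self_eq_0[OF fin\<gamma>[OF that]] by (auto simp: c_def ip_def)
    finally show ?thesis
      by (simp add: f_def ip_diff_right ip_sum_right)
  qed
  then have Pf: "?P (lin f)"
    using P[OF f] by blast
  have "lanczos_C L B0 n = lin f"
    unfolding lanczos_C.simps[of L B0 n]
  proof (rule the_equality[of ?P, OF Pf])
    fix C assume C: "?P C"
    then obtain g where g: "C = lin g" "spanned \<beta> n (\<lambda>s. g s - \<beta> n s)"
      using ex by blast
    have "spanned \<beta> n (\<lambda>s. (g s - \<beta> n s) + - 1 * (f s - \<beta> n s))"
      using f g(2) by (intro spanned_add spanned_scale)
    then have "spanned \<beta> n (\<lambda>s. g s - f s)"
      by simp
    moreover have "ip (\<gamma> j) (\<lambda>s. g s - f s) = 0" if "j < n" for j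
      using that C Pf P[OF f] P[OF g(2)] g(1) by (simp add: ip_diff_right)
    ultimately have "(\<lambda>s. g s - f s) = (\<lambda>_. 0)"
      using gram_schmidt_unique[of n \<beta> \<gamma> "\<lambda>s. g s - f s"] \<gamma>(2) B(2) fin\<gamma> by blast
    then have "g = f"
      by (simp add: fun_eq_iff)
    then show "C = lin f"
      using g(1) by simp
  qed
  then show ?case
    using f Pf by auto
qed

text \<open>The quotients telescope as long as no earlier norm vanishes. For each
  \<open>j < n\<close>, \<open>indep\<close> supplies a string that first occurs in
  \<open>\<beta> j\<close>; Gram-Schmidt leaves its coefficient unchanged, so the norm is
  positive.\<close>

lemma prod_lanczos_b_ge:
  assumes B: "\<And>n. krylov_B L B0 n = lin (\<beta> n)" "\<And>n. fin (\<beta> n)"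
    and unit: "ip (\<beta> 0) (\<beta> 0) = 1"
    and indep: "\<And>j. j < n \<Longrightarrow> \<exists>t. \<beta> j t \<noteq> 0 \<and> (\<forall>i<j. \<beta> i t = 0)"
    and t: "\<And>i. i < n \<Longrightarrow> \<beta> i t = 0"
  shows "cmod (\<beta> n t) \<le> (\<Prod>j=1..n. lanczos_b L B0 j)"
proof -
  obtain \<gamma> where \<gamma>: "\<And>n. lanczos_C L B0 n = lin (\<gamma> n)" "\<And>n. spanned \<beta> n (\<lambda>s. \<gamma> n s - \<beta> n s)"
    using lanczos_C_eq[of L B0 \<beta>, OF B] by metis
  define N where "N j = Re (ip (\<gamma> j) (\<gamma> j))" for j
  have fin: "fin (\<gamma> j)" for j
    using fin_add[OF fin_spanned[OF B(2) \<gamma>(2)[of j]] B(2)[of j]] by simp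
  have eq: "\<gamma> j s = \<beta> j s" if "\<And>i. i < j \<Longrightarrow> \<beta> i s = 0" for j s
  proof -
    obtain \<alpha> where "(\<lambda>s. \<gamma> j s - \<beta> j s) = (\<lambda>s. \<Sum>i<j. \<alpha> i * \<beta> i s)"
      using \<gamma>(2)[of j] by (auto simp: spanned_def)
    then have "\<gamma> j s - \<beta> j s = (\<Sum>i<j. \<alpha> i * \<beta> i s)"
      by meson
    with that show ?thesis
      by simp
  qed
  have ge: "(cmod (\<beta> j s))\<^sup>2 \<le> N j" if "\<And>i. i < j \<Longrightarrow> \<beta> i s = 0" for j s
    using norm_le_ip_self[OF fin, of j s] eq[OF that] by (simp add: N_def)
  have pos: "N j > 0" if "j < n" for j
  proof -
    obtain s where s: "\<beta> j s \<noteq> 0" "\<And>i. i < j \<Longrightarrow> \<beta> i s = 0"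
      using indep[OF \<open>j < n\<close>] by blast
    then have "0 < (cmod (\<beta> j s))\<^sup>2"
      by simp
    moreover have "(cmod (\<beta> j s))\<^sup>2 \<le> N j"
      by (rule ge) (rule s(2))
    ultimately show ?thesis
      by linarith
  qed
  have b: "lanczos_b L B0 j = sqrt (N j / N (j - 1))" for j
    by (simp add: lanczos_b_def \<gamma>(1) op_inner_lin fin N_def)
  have "\<gamma> 0 = \<beta> 0"
    using eq[of 0] by (intro ext) simp
  then have "N 0 = 1"
    using unit by (simp add: N_def)
  have "(\<Prod>j=1..m. lanczos_b L B0 j) = sqrt (N m)" if "m \<le> n" for m
    using that
  proof (induction m)
    case 0
    then show ?case
      using \<open>N 0 = 1\<close> by simp
  next
    case (Suc m)
    then have "(\<Prod>j=1..Suc m. lanczos_b L B0 j) = sqrt (N m) * sqrt (N (Suc m) / N m)"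
      by (simp add: b)
    also have "\<dots> = sqrt (N (Suc m))"
      using pos[of m] Suc.prems by (simp add: real_sqrt_divide)
    finally show ?case .
  qed
  then have "(\<Prod>j=1..n. lanczos_b L B0 j) = sqrt (N n)"
    by simp
  moreover have "cmod (\<beta> n t) \<le> sqrt (N n)"
    using ge[OF t] by (intro real_le_rsqrt)
  ultimately show ?thesis
    by simp
qed

section \<open>Growth sequences\<close>

definition nbr :: "('d::finite) site \<Rightarrow> 'd site \<Rightarrow> bool" where
  "nbr u v \<longleftrightarrow> up u v \<or> up v u"

text \<open>Sites are appended at the right end, so the last entry is the one created by the
  outermost commutator.\<close>

inductive growth :: "('d::finite) site list \<Rightarrow> bool" where
  growth_init: "growth [0]"
| growth_snoc: "growth xs \<Longrightarrow> x \<notin> set xs \<Longrightarrow> u \<in> set xs \<Longrightarrow> nbr u x \<Longrightarrow> growth (xs @ [x])"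

definition orders :: "('d::finite) site set \<Rightarrow> 'd site list set" where
  "orders U = {xs. growth xs \<and> set xs = U}"

abbreviation grown :: "('d::finite) site set \<Rightarrow> bool" where
  "grown U \<equiv> orders U \<noteq> {}"

lemma grown_iff: "grown U \<longleftrightarrow> (\<exists>xs. growth xs \<and> set xs = U)"
  by (auto simp: orders_def)

lemma growth_distinct: "growth xs \<Longrightarrow> distinct xs"
  by (induction rule: growth.induct) auto

lemma zero_in_growth: "growth xs \<Longrightarrow> 0 \<in> set xs"
  by (induction rule: growth.induct) auto

lemma grown_insert:
  assumes "grown U" "u \<in> U" "nbr u x"
  shows "grown (insert x U)"
proof -
  obtain xs where xs: "growth xs" "set xs = U"
    using assms(1) by (auto simp: grown_iff)
  show ?thesis
  proof (cases "x \<in> U")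
    case True
    with assms(1) show ?thesis
      by (simp add: insert_absorb)
  next
    case False
    then have "growth (xs @ [x])"
      using xs assms by (intro growth_snoc[of xs x u]) auto
    then show ?thesis
      using xs unfolding grown_iff by (intro exI[of _ "xs @ [x]"]) auto
  qed
qed

lemma growth_take:
  assumes "growth xs" "0 < k" "k \<le> length xs"
  shows "growth (take k xs)"
  using assms
proof (induction arbitrary: k rule: growth.induct)
  case growth_init
  then have "k = 1"
    by simp
  then show ?case
    by (simp add: growth.growth_init)
next
  case (growth_snoc xs x u)
  then show ?case
    by (cases "k \<le> length xs") (auto intro: growth.growth_snoc)
qed

lemma finite_orders: "finite (orders U)"
proof (cases "finite U")
  case True
  have "orders U \<subseteq> {xs. set xs \<subseteq> U \<and> length xs = card U}"
    using growth_distinct distinct_card by (fastforce simp: orders_def)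
  with True show ?thesis
    using finite_lists_length_eq finite_subset by blast
next
  case False
  then have "orders U = {}"
    by (auto simp: orders_def)
  then show ?thesis
    by simp
qed

lemma grown_singleton:
  assumes "grown U" "card U = 1"
  shows "U = {0}"
proof -
  have "0 \<in> U"
    using assms(1) zero_in_growth unfolding grown_iff by blast
  with assms(2) show ?thesis
    by (auto simp: card_1_singleton_iff)
qed

lemma orders_singleton: "orders {0} = {[0]}"
proof (intro equalityI subsetI)
  fix xs :: "'a site list"
  assume "xs \<in> orders {0}"
  then have xs: "distinct xs" "set xs = {0}"
    using growth_distinct by (auto simp: orders_def)
  then have "length xs = 1"
    using distinct_card by fastforce
  with xs show "xs \<in> {[0]}"
    by (cases xs) auto
qed (auto simp: orders_def growth_init)

text \<open>The possible final entries of a growth order, when \<open>U\<close> has at least two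
  sites; in a forest they are leaves.\<close>

definition last_sites :: "('d::finite) site set \<Rightarrow> 'd site set" where
  "last_sites U = {x \<in> U. grown (U - {x}) \<and> (\<exists>u\<in>U - {x}. nbr u x)}"

text \<open>Sorts the orders by their last site. Up to the weight, the coefficients of the Krylov
  operators obey the same recursion.\<close>

lemma card_orders:
  assumes "finite U" "card U \<ge> 2"
  shows "card (orders U) = (\<Sum>x\<in>last_sites U. card (orders (U - {x})))"
proof -
  have "orders U = (\<Union>x\<in>last_sites U. (\<lambda>xs. xs @ [x]) ` orders (U - {x}))"
  proof (intro equalityI subsetI)
    fix ys assume "ys \<in> orders U"
    then have "growth ys" and U: "set ys = U"
      by (auto simp: orders_def)
    then show "ys \<in> (\<Union>x\<in>last_sites U. (\<lambda>xs. xs @ [x]) ` orders (U - {x}))"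
    proof cases
      case growth_init
      with U assms(2) show ?thesis
        by auto
    next
      case (growth_snoc xs x u)
      then have "set xs = U - {x}"
        using U by auto
      moreover from this have "x \<in> last_sites U"
        using growth_snoc U by (auto simp: last_sites_def grown_iff)
      ultimately show ?thesis
        using growth_snoc by (auto simp: orders_def)
    qed
  next
    fix ys assume "ys \<in> (\<Union>x\<in>last_sites U. (\<lambda>xs. xs @ [x]) ` orders (U - {x}))"
    then obtain x xs where x: "x \<in> last_sites U" "growth xs" "set xs = U - {x}" "ys = xs @ [x]"
      by (auto simp: orders_def)
    then obtain u where "u \<in> U - {x}" "nbr u x"
      by (auto simp: last_sites_def)
    then have "growth ys"
      using x by (auto intro: growth_snoc)
    with x show "ys \<in> orders U"
      by (auto simp: orders_def last_sites_def)
  qed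
  also have "card \<dots> = (\<Sum>x\<in>last_sites U. card ((\<lambda>xs. xs @ [x]) ` orders (U - {x})))"
    using assms(1) finite_orders
    by (intro card_UN_disjoint) (auto simp: last_sites_def)
  also have "\<dots> = (\<Sum>x\<in>last_sites U. card (orders (U - {x})))"
    by (intro sum.cong refl card_image) (auto simp: inj_on_def)
  finally show ?thesis .
qed

section \<open>Supports of the Krylov operators\<close>

lemma hamsum_nonzeroE:
  assumes "hamsum I A c e f t \<noteq> 0"
  obtains i a where "i \<in> I" "a \<in> A" "comm (e i a) f t \<noteq> 0"
proof -
  obtain a where a: "a \<in> A" "(\<Sum>i | i \<in> I \<and> comm (e i a) f t \<noteq> 0. c a * comm (e i a) f t) \<noteq> 0"
    using assms unfolding hamsum_def by (meson sum.neutral)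
  then obtain i where "i \<in> {i. i \<in> I \<and> comm (e i a) f t \<noteq> 0}"
    by (meson sum.neutral)
  with a show thesis
    by (auto intro: that)
qed

text \<open>A nonzero commutator requires a common site, so at most one end of the bond is
  new.\<close>

lemma supp_insert_of_bond:
  assumes "comm (bondstr b a) f t \<noteq> 0" "a \<noteq> PI" "b \<in> bonds"
  obtains u x where "b = (u, x) \<or> b = (x, u)" "nbr u x" "u \<in> supp (bondstr b a \<cdot> t)"
    "supp t \<subseteq> insert x (supp (bondstr b a \<cdot> t))"
proof -
  let ?s = "bondstr b a \<cdot> t"
  have sub: "supp t \<subseteq> {fst b, snd b} \<union> supp ?s"
    using supp_smult[of "bondstr b a" ?s] assms(2) by simp
  have "fst b \<in> supp ?s \<or> snd b \<in> supp ?s"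
    using comm_nonzeroD(2)[OF assms(1)] assms(2) by auto
  then show thesis
  proof
    assume "fst b \<in> supp ?s"
    with sub assms(3) show thesis
      by (intro that[of "fst b" "snd b"]) (auto simp: nbr_def bonds_iff)
  next
    assume "snd b \<in> supp ?s"
    with sub assms(3) show thesis
      by (intro that[of "snd b" "fst b"]) (auto simp: nbr_def bonds_iff)
  qed
qed

lemma supp_subset_of_site:
  assumes "comm (sitestr u a) f t \<noteq> 0" "a \<noteq> PI"
  shows "supp t \<subseteq> supp (sitestr u a \<cdot> t)"
  using comm_nonzeroD(2)[OF assms(1)] supp_smult[of "sitestr u a" "sitestr u a \<cdot> t"] assms(2)
  by auto

text \<open>A support of maximal size forces the preceding one to be maximal too, and one site
  smaller; the bound and its equality case therefore go through one induction.\<close>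

lemma kry_supp:
  assumes "kry J h n t \<noteq> 0"
  shows "finite (supp t)" "card (supp t) \<le> Suc n" "card (supp t) = Suc n \<Longrightarrow> grown (supp t)"
proof -
  have "finite (supp t) \<and> card (supp t) \<le> Suc n \<and> (card (supp t) = Suc n \<longrightarrow> grown (supp t))"
    using assms
  proof (induction n arbitrary: t)
    case 0
    then have "t = sitestr 0 PX"
      by (auto split: if_splits)
    then show ?case
      by (auto simp: orders_singleton)
  next
    case (Suc n)
    let ?f = "kry J h n"
    have "ham J h ?f t \<noteq> 0"
      using Suc.prems by simp
    then consider "hamsum bonds xyz (\<lambda>a. complex_of_real (- J a / 2)) bondstr ?f t \<noteq> 0"
      | "hamsum UNIV xyz (\<lambda>a. complex_of_real (- h a)) sitestr ?f t \<noteq> 0"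
      unfolding ham_def by fastforce
    then show ?case
    proof cases
      case 1
      then obtain b a where b: "b \<in> bonds" and a: "a \<in> xyz" and ne: "comm (bondstr b a) ?f t \<noteq> 0"
        by (rule hamsum_nonzeroE)
      define s where "s = bondstr b a \<cdot> t"
      obtain u x where ux: "nbr u x" "u \<in> supp s" "supp t \<subseteq> insert x (supp s)"
      proof (rule supp_insert_of_bond[OF ne _ b, folded s_def])
        show "a \<noteq> PI"
          using a by auto
      qed
      have "?f s \<noteq> 0"
        unfolding s_def using comm_nonzeroD(1)[OF ne] .
      note s = Suc.IH[OF this]
      have le: "card (supp t) \<le> card (insert x (supp s))"
        using s ux(3) by (intro card_mono) auto
      have le': "card (insert x (supp s)) \<le> Suc (card (supp s))"
        by (rule card_insert_le_m1) auto
      have "grown (supp t)" if "card (supp t) = Suc (Suc n)"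
      proof -
        have "card (supp s) = Suc n" "card (insert x (supp s)) = Suc (Suc n)"
          using le le' that s by auto
        then have "grown (supp s)"
          using s by simp
        then have "grown (insert x (supp s))"
          using ux(2,1) by (rule grown_insert)
        moreover have "supp t = insert x (supp s)"
          using s ux(3) that \<open>card (insert x (supp s)) = Suc (Suc n)\<close>
          by (intro card_subset_eq) auto
        ultimately show ?thesis
          by simp
      qed
      then show ?thesis
        using le le' s finite_subset[OF ux(3)] by auto
    next
      case 2
      then obtain u a where a: "a \<in> xyz" and ne: "comm (sitestr u a) ?f t \<noteq> 0"
        by (rule hamsum_nonzeroE)
      have "?f (sitestr u a \<cdot> t) \<noteq> 0"
        using comm_nonzeroD(1)[OF ne] .
      note s = Suc.IH[OF this]
      have sub: "supp t \<subseteq> supp (sitestr u a \<cdot> t)"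
        using supp_subset_of_site[OF ne] a by blast
      then have "card (supp t) \<le> card (supp (sitestr u a \<cdot> t))"
        using s by (intro card_mono) auto
      then show ?thesis
        using s finite_subset[OF sub] by auto
    qed
  qed
  then show "finite (supp t)" "card (supp t) \<le> Suc n" "card (supp t) = Suc n \<Longrightarrow> grown (supp t)"
    by auto
qed

section \<open>The coefficients of tree patterns\<close>

text \<open>The first condition makes the origin a root, the second gives each site at most one
  parent along \<open>up\<close>.\<close>

definition forest :: "('d::finite) site set \<Rightarrow> bool" where
  "forest U \<longleftrightarrow> (\<forall>u\<in>U. \<not> up u 0) \<and> (\<forall>u\<in>U. \<forall>u'\<in>U. \<forall>v\<in>U. up u v \<longrightarrow> up u' v \<longrightarrow> u = u')"

lemma forest_mono: "forest T \<Longrightarrow> U \<subseteq> T \<Longrightarrow> forest U"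
  unfolding forest_def by blast

text \<open>Growth never steps down inside a forest: a new site below an old one would be its
  parent, and parents are already present by induction.\<close>

lemma grown_closed:
  assumes "forest T" "grown U" "U \<subseteq> T" "v \<in> U" "u \<in> T" "up u v"
  shows "u \<in> U"
proof -
  obtain xs where xs: "growth xs" "set xs = U"
    using assms(2) by (auto simp: grown_iff)
  have "\<forall>v\<in>set xs. \<forall>u\<in>T. up u v \<longrightarrow> u \<in> set xs" if "set xs \<subseteq> T"
    using xs(1) that
  proof induction
    case growth_init
    then show ?case
      using assms(1) by (auto simp: forest_def)
  next
    case (growth_snoc xs x p)
    have "w \<in> set xs" if "w \<in> T" "up w x" for w
    proof (cases "up p x")
      case True
      then have "w = p"
        using assms(1) growth_snoc that unfolding forest_def by auto
      then show ?thesis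
        using growth_snoc by simp
    next
      case False
      then have "up x p"
        using growth_snoc by (simp add: nbr_def)
      then show ?thesis
        using growth_snoc by auto
    qed
    then show ?case
      using growth_snoc by auto
  qed
  then show ?thesis
    using xs assms by blast
qed

definition kids :: "('d::finite) site set \<Rightarrow> 'd site \<Rightarrow> 'd site set" where
  "kids U v = {w \<in> U. up v w}"

text \<open>The matrix that the bond from its parent creates at \<open>v\<close>; even sites get X
  because the origin must carry the initial operator.\<close>

definition kind :: "('d::finite) site \<Rightarrow> pauli" where
  "kind v = (if even (height v) then PX else PY)"

text \<open>It anticommutes with both states of \<open>v\<close>, which are \<open>kind v\<close>
  and \<open>PZ\<close>, and multiplication by it exchanges them up to a phase.\<close>

definition kid_kind :: "('d::finite) site \<Rightarrow> pauli" where
  "kid_kind v = (if even (height v) then PY else PX)"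

definition pattern :: "('d::finite) site set \<Rightarrow> 'd string" where
  "pattern U v = (if v \<notin> U then PI else if odd (card (kids U v)) then PZ else kind v)"

text \<open>The factor gained when \<open>v\<close>, with \<open>j\<close> children so far, receives
  the next one. The coupling appears without 1/2 because both orientations of the bond
  contribute.\<close>

definition fac :: "(pauli \<Rightarrow> real) \<Rightarrow> ('d::finite) site \<Rightarrow> nat \<Rightarrow> complex" where
  "fac J v j = \<i> * complex_of_real (- J (kid_kind v)) *
     (pauli_phase (kid_kind v) (if odd j then PZ else kind v)
    - pauli_phase (if odd j then PZ else kind v) (kid_kind v))"

definition weight :: "(pauli \<Rightarrow> real) \<Rightarrow> ('d::finite) site set \<Rightarrow> complex" where
  "weight J U = (\<Prod>v\<in>U. \<Prod>j<card (kids U v). fac J v j)"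

lemma kid_kind_up: "up u x \<Longrightarrow> kid_kind u = kind x"
  using height_up by (fastforce simp: kid_kind_def kind_def)

lemma supp_pattern [simp]: "supp (pattern U) = U"
  by (auto simp: supp_def pattern_def kind_def)

text \<open>The two matrices anticommute, so the phases are i and -i in some order and their
  difference has modulus 2.\<close>

lemma norm_fac: "cmod (fac J v j) = 2 * \<bar>J (kid_kind v)\<bar>"
proof -
  have *: "cmod (- \<i> - \<i>) = 2" "cmod (\<i> + \<i>) = 2"
    by (simp_all add: cmod_def)
  show ?thesis
    using * by (auto simp: fac_def norm_mult kid_kind_def kind_def)
qed

lemma last_site_up:
  assumes "forest U" "x \<in> last_sites U" "u \<in> U - {x}" "nbr u x"
  shows "up u x"
proof -
  have "\<not> up x u"
    using grown_closed[OF assms(1), of "U - {x}" u x] assms by (auto simp: last_sites_def)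
  with assms(4) show ?thesis
    by (simp add: nbr_def)
qed

text \<open>A last site is a leaf because the set without it is closed under parents; removing it
  changes the number of children only at its parent.\<close>

lemma kids_last_site:
  assumes "forest U" "x \<in> last_sites U" "u \<in> U" "up u x"
  shows "kids U x = {}" "kids U u = insert x (kids (U - {x}) u)"
    "v \<in> U \<Longrightarrow> v \<noteq> u \<Longrightarrow> kids U v = kids (U - {x}) v"
proof -
  have "\<not> up x x"
    using height_up by force
  then show "kids U x = {}"
    using grown_closed[OF assms(1), of "U - {x}" _ x] assms by (fastforce simp: last_sites_def kids_def)
  show "kids U u = insert x (kids (U - {x}) u)"
    using assms by (auto simp: kids_def last_sites_def)
  show "kids U v = kids (U - {x}) v" if "v \<in> U" "v \<noteq> u"
    using that assms unfolding kids_def forest_def by (auto simp: last_sites_def)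
qed

text \<open>Multiplication by the bond string undoes one growth step: it cancels the matrix at the
  leaf and exchanges the two states of the parent, whose number of children changes parity.\<close>

lemma last_site_step:
  assumes "forest U" "finite U" "x \<in> last_sites U" "u \<in> U" "up u x"
  shows "bondstr (u, x) (kind x) \<cdot> pattern U = pattern (U - {x})" (is ?A)
    and "weight J U = weight J (U - {x}) * fac J u (card (kids (U - {x}) u))" (is ?B)
    and "\<i> * (complex_of_real (- J (kind x)) * comm (bondstr (u, x) (kind x)) f (pattern U))
      = fac J u (card (kids (U - {x}) u)) * f (pattern (U - {x}))" (is ?C)
proof -
  note kids = kids_last_site[OF assms(1,3,4,5)]
  have ux: "u \<noteq> x"
    using assms(5) height_up by force
  have xU: "x \<in> U"
    using assms(3) by (simp add: last_sites_def)
  have card: "card (kids U u) = Suc (card (kids (U - {x}) u))"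
    using assms(2) by (simp add: kids(2)) (simp add: kids_def)
  have kind: "kind u = (if even (height u) then PX else PY)" "kind x = (if even (height u) then PY else PX)"
    using height_up[OF assms(5)] by (simp_all add: kind_def)
  show ?A
  proof
    fix v
    consider "v = x" | "v = u" | "v \<noteq> x" "v \<noteq> u" "v \<in> U" | "v \<noteq> x" "v \<noteq> u" "v \<notin> U"
      by blast
    then show "(bondstr (u, x) (kind x) \<cdot> pattern U) v = pattern (U - {x}) v"
    proof cases
      case 1
      then show ?thesis
        using xU by (simp add: smult_def bondstr_def pattern_def kids(1))
    next
      case 2
      then show ?thesis
        using ux assms(4) by (auto simp: smult_def bondstr_def pattern_def card kind)
    next
      case 3
      then show ?thesis
        using kids(3)[of v] by (simp add: smult_def bondstr_def pattern_def)
    next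
      case 4
      then show ?thesis
        by (simp add: smult_def bondstr_def pattern_def)
    qed
  qed
  show ?B
  proof -
    let ?g = "\<lambda>U v. \<Prod>j<card (kids U v). fac J v j"
    have "weight J U = ?g U u * (?g U x * (\<Prod>v\<in>U - {u} - {x}. ?g U v))"
      unfolding weight_def using assms(2,4) xU ux
      by (subst prod.remove[of U u], simp, simp, subst prod.remove[of "U - {u}" x]) auto
    also have "?g U x = 1"
      by (simp add: kids(1))
    also have "?g U u = fac J u (card (kids (U - {x}) u)) * ?g (U - {x}) u"
      by (simp add: card mult.commute)
    also have "(\<Prod>v\<in>U - {u} - {x}. ?g U v) = (\<Prod>v\<in>U - {x} - {u}. ?g (U - {x}) v)"
      using kids(3) by (intro prod.cong) auto
    also have "fac J u (card (kids (U - {x}) u)) * ?g (U - {x}) u * (1 * (\<Prod>v\<in>U - {x} - {u}. ?g (U - {x}) v))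
        = weight J (U - {x}) * fac J u (card (kids (U - {x}) u))"
    proof -
      have "weight J (U - {x}) = ?g (U - {x}) u * (\<Prod>v\<in>U - {x} - {u}. ?g (U - {x}) v)"
        unfolding weight_def using assms(2,4) ux by (intro prod.remove) auto
      then show ?thesis
        by (simp add: mult_ac)
    qed
    finally show ?thesis .
  qed
  show ?C
  proof -
    let ?e = "bondstr (u, x) (kind x)" and ?s = "pattern (U - {x})"
    have ne: "kind x \<noteq> PI"
      by (simp add: kind)
    have "sphase ?e ?s = (\<Prod>w\<in>{u, x}. pauli_phase (?e w) (?s w))"
      "sphase ?s ?e = (\<Prod>w\<in>{u, x}. pauli_phase (?s w) (?e w))"
      using ne by (intro sphase_eq_prod; auto)+
    then have "sphase ?e ?s = pauli_phase (kind x) (?s u)" "sphase ?s ?e = pauli_phase (?s u) (kind x)"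
      using ux by (simp_all add: bondstr_def pattern_def)
    moreover have "?s u = (if odd (card (kids (U - {x}) u)) then PZ else kind u)"
      using ux assms(4) by (simp add: pattern_def)
    ultimately show ?thesis
      unfolding comm_def \<open>?A\<close> fac_def by (simp add: kid_kind_up[OF assms(5)])
  qed
qed

text \<open>By counting sites, the preceding string lacks exactly one site \<open>x\<close> of
  \<open>U\<close>, which is then a last site. There the bond must cancel the matrix
  \<open>kind x\<close> of a leaf, and this determines its type.\<close>

lemma comm_pattern_nonzeroE:
  assumes U: "forest U" "finite U" "card U = Suc (Suc n)"
    and ne: "comm (bondstr b a) (kry J h n) (pattern U) \<noteq> 0" and "a \<noteq> PI" "b \<in> bonds"
  obtains u x where "b = (u, x) \<or> b = (x, u)" "x \<in> last_sites U" "u \<in> U" "up u x" "a = kind x"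
proof -
  define s where "s = bondstr b a \<cdot> pattern U"
  obtain u x where ux: "b = (u, x) \<or> b = (x, u)" "nbr u x" "u \<in> supp s" "U \<subseteq> insert x (supp s)"
    by (rule supp_insert_of_bond[OF ne \<open>a \<noteq> PI\<close> \<open>b \<in> bonds\<close>, folded s_def]) auto
  have "kry J h n s \<noteq> 0"
    using comm_nonzeroD(1)[OF ne] by (simp add: s_def)
  note s = kry_supp[OF this]
  have "Suc (Suc n) \<le> card (insert x (supp s))"
    using ux(4) s(1) U(3) by (metis card_mono finite_insert)
  then have xs: "x \<notin> supp s" "card (supp s) = Suc n"
    using s by (auto simp: card_insert_if split: if_splits)
  have "U = insert x (supp s)"
    using ux(4) s(1) xs U by (intro card_subset_eq) auto
  then have supp: "supp s = U - {x}" "x \<in> U"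
    using xs by auto
  have last: "x \<in> last_sites U"
    using supp s(3)[OF xs(2)] ux by (auto simp: last_sites_def)
  have up: "up u x"
    using last_site_up[OF U(1) last] ux supp by auto
  have "s x = PI"
    using xs(1) by (simp add: supp_def)
  moreover have "s x = pauli_mult a (pattern U x)"
    using ux(1) by (auto simp: s_def smult_def bondstr_def)
  moreover have "pattern U x = kind x"
    using kids_last_site(1)[OF U(1) last _ up] ux(3) supp by (simp add: pattern_def)
  ultimately show thesis
    using that ux last up supp by auto
qed

text \<open>Whichever site \<open>x\<close> comes last, the weight of \<open>U - {x}\<close> times
  the factor of the last step is the weight of \<open>U\<close>; so the weight factors out and the
  numbers of orders add up.\<close>

lemma kry_pattern:
  assumes "forest U" "finite U" "grown U" "card U = Suc n"
  shows "kry J h n (pattern U) = weight J U * of_nat (card (orders U))"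
  using assms
proof (induction n arbitrary: U)
  case 0
  then have "U = {0}"
    using grown_singleton by auto
  moreover have "\<not> up (0 :: 'a site) 0"
    using height_up by force
  then have "kids {0} (0 :: 'a site) = {}"
    by (auto simp: kids_def)
  moreover have "height (0 :: 'a site) = 0"
    by (simp add: height_def)
  ultimately show ?case
    by (auto simp: pattern_def sitestr_def weight_def orders_singleton kind_def fun_eq_iff)
next
  case (Suc n)
  let ?f = "kry J h n" and ?t = "pattern U" and ?R = "last_sites U"
  note U = Suc.prems(1,2,4)
  have finR: "finite ?R"
    using U(2) by (simp add: last_sites_def)
  have "\<exists>u\<in>U. up u x" if "x \<in> ?R" for x
    using that last_site_up[OF U(1) that] by (auto simp: last_sites_def)
  then obtain par where par: "\<And>x. x \<in> ?R \<Longrightarrow> par x \<in> U \<and> up (par x) x"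
    by metis
  have par_unique: "u = par x" if "x \<in> ?R" "u \<in> U" "up u x" for u x
    using par[OF that(1)] that U(1) unfolding forest_def last_sites_def by blast
  \<comment> \<open>\<open>U\<close> has \<open>n + 2\<close> sites, more than any string of the
    preceding operator, and a field term adds none.\<close>
  have site: "hamsum UNIV xyz (\<lambda>a. complex_of_real (- h a)) sitestr ?f ?t = 0"
  proof (rule ccontr)
    assume "\<not> ?thesis"
    then obtain u a where a: "a \<in> xyz" and ne: "comm (sitestr u a) ?f ?t \<noteq> 0"
      by (rule hamsum_nonzeroE)
    have "?f (sitestr u a \<cdot> ?t) \<noteq> 0"
      using comm_nonzeroD(1)[OF ne] .
    note s = kry_supp[OF this]
    have "U \<subseteq> supp (sitestr u a \<cdot> ?t)"
      using supp_subset_of_site[OF ne] a by auto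
    then have "card U \<le> Suc n"
      using s card_mono order_trans by metis
    then show False
      using U(3) by simp
  qed
  define g where "g x = complex_of_real (- J (kind x)) * comm (bondstr (par x, x) (kind x)) ?f ?t" for x
  have inner: "(\<Sum>b | b \<in> bonds \<and> comm (bondstr b a) ?f ?t \<noteq> 0.
      complex_of_real (- J a / 2) * comm (bondstr b a) ?f ?t) = (\<Sum>x | x \<in> ?R \<and> kind x = a. g x)"
    if a: "a \<in> xyz" for a
  proof -
    let ?Ra = "{x. x \<in> ?R \<and> kind x = a}"
    let ?c = "\<lambda>b. complex_of_real (- J a / 2) * comm (bondstr b a) ?f ?t"
    \<comment> \<open>The two orientations of each bond; together they cancel the factor
      1/2.\<close>
    let ?up = "\<lambda>x. (par x, x)" and ?down = "\<lambda>x. (x, par x)"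
    have Ra: "finite ?Ra"
      using finR by simp
    have "(\<Sum>b | b \<in> bonds \<and> comm (bondstr b a) ?f ?t \<noteq> 0. ?c b) = (\<Sum>b\<in>?up ` ?Ra \<union> ?down ` ?Ra. ?c b)"
    proof (rule sum.mono_neutral_left)
      show "{b. b \<in> bonds \<and> comm (bondstr b a) ?f ?t \<noteq> 0} \<subseteq> ?up ` ?Ra \<union> ?down ` ?Ra"
      proof
        fix b assume "b \<in> {b. b \<in> bonds \<and> comm (bondstr b a) ?f ?t \<noteq> 0}"
        then obtain u x where "b = (u, x) \<or> b = (x, u)" "x \<in> ?R" "u \<in> U" "up u x" "a = kind x"
          using comm_pattern_nonzeroE[OF U, of b a J h] a by blast
        then show "b \<in> ?up ` ?Ra \<union> ?down ` ?Ra"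
          using par_unique by blast
      qed
      show "\<forall>b\<in>?up ` ?Ra \<union> ?down ` ?Ra - {b. b \<in> bonds \<and> comm (bondstr b a) ?f ?t \<noteq> 0}. ?c b = 0"
        using par by (auto simp: bonds_iff)
    qed (use Ra in auto)
    also have "\<dots> = (\<Sum>b\<in>?up ` ?Ra. ?c b) + (\<Sum>b\<in>?down ` ?Ra. ?c b)"
    proof (rule sum.union_disjoint)
      \<comment> \<open>Two sites cannot be parents of each other, since a parent is lower by
        1.\<close>
      have "x \<noteq> par y \<or> y \<noteq> par x" if "x \<in> ?R" "y \<in> ?R" for x y
        using height_up[of "par x" x] height_up[of "par y" y] par[OF that(1)] par[OF that(2)] by auto
      then show "?up ` ?Ra \<inter> ?down ` ?Ra = {}"
        by fastforce
    qed (use Ra in auto)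
    also have "(\<Sum>b\<in>?up ` ?Ra. ?c b) = (\<Sum>x\<in>?Ra. ?c (par x, x))"
      by (subst sum.reindex) (auto simp: inj_on_def)
    also have "(\<Sum>b\<in>?down ` ?Ra. ?c b) = (\<Sum>x\<in>?Ra. ?c (x, par x))"
      by (subst sum.reindex) (auto simp: inj_on_def)
    also have "(\<Sum>x\<in>?Ra. ?c (par x, x)) + (\<Sum>x\<in>?Ra. ?c (x, par x)) = (\<Sum>x\<in>?Ra. g x)"
    proof -
      have "bondstr (x, par x) a = bondstr (par x, x) a" for x
        by (auto simp: bondstr_def)
      then have "?c (par x, x) + ?c (x, par x) = g x" if "x \<in> ?Ra" for x
        using that by (simp add: g_def)
      then show ?thesis
        by (simp flip: sum.distrib)
    qed
    finally show ?thesis .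
  qed
  have "hamsum bonds xyz (\<lambda>a. complex_of_real (- J a / 2)) bondstr ?f ?t
      = (\<Sum>a\<in>xyz. \<Sum>x | x \<in> ?R \<and> kind x = a. g x)"
    unfolding hamsum_def by (rule sum.cong[OF refl]) (rule inner)
  also have "\<dots> = (\<Sum>x\<in>?R. g x)"
    using finR by (intro sum.group) (auto simp: kind_def)
  finally have "kry J h (Suc n) ?t = (\<Sum>x\<in>?R. \<i> * g x)"
    by (simp only: kry.simps ham_def site add_0_right sum_distrib_left)
  also have "\<dots> = (\<Sum>x\<in>?R. weight J U * of_nat (card (orders (U - {x}))))"
  proof (rule sum.cong[OF refl])
    fix x assume x: "x \<in> ?R"
    have "\<i> * g x = fac J (par x) (card (kids (U - {x}) (par x))) * ?f (pattern (U - {x}))"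
      unfolding g_def using last_site_step(3)[OF U(1,2) x] par[OF x] by blast
    moreover have "?f (pattern (U - {x})) = weight J (U - {x}) * of_nat (card (orders (U - {x})))"
      using x U by (intro Suc.IH forest_mono[OF U(1)]) (auto simp: last_sites_def)
    moreover have "weight J U = weight J (U - {x}) * fac J (par x) (card (kids (U - {x}) (par x)))"
      using last_site_step(2)[OF U(1,2) x] par[OF x] by blast
    ultimately show "\<i> * g x = weight J U * of_nat (card (orders (U - {x})))"
      by simp
  qed
  also have "\<dots> = weight J U * of_nat (card (orders U))"
    using card_orders[of U] U by (simp add: sum_distrib_left)
  finally show ?case .
qed

text \<open>A grown tree with \<open>n + 1\<close> sites has \<open>n\<close> edges from parent to
  child, each contributing one factor; the edges are counted by removing last sites.\<close>

lemma norm_weight_ge: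
  assumes "forest U" "finite U" "grown U" "card U = Suc n"
    and "m \<ge> 0" "m \<le> \<bar>J PX\<bar>" "m \<le> \<bar>J PY\<bar>"
  shows "(2 * m) ^ n \<le> cmod (weight J U)"
  using assms(1-4)
proof (induction n arbitrary: U)
  case 0
  then have "U = {0}"
    using grown_singleton by auto
  moreover have "kids {0} (0 :: 'a site) = {}"
    using height_up by (force simp: kids_def)
  ultimately show ?case
    by (simp add: weight_def)
next
  case (Suc n)
  note U = Suc.prems(1,2,4)
  have "card (orders U) \<noteq> 0"
    using Suc.prems(3) finite_orders by (simp add: card_gt_0_iff)
  then obtain x where x: "x \<in> last_sites U"
    using card_orders[of U] U by fastforce
  then obtain u where u: "u \<in> U" "up u x"
    using last_site_up[OF U(1) x] by (auto simp: last_sites_def)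
  have "(2 * m) ^ n \<le> cmod (weight J (U - {x}))"
    using x U by (intro Suc.IH forest_mono[OF U(1)]) (auto simp: last_sites_def)
  moreover have "2 * m \<le> cmod (fac J u (card (kids (U - {x}) u)))"
    using assms(6,7) by (auto simp: norm_fac kid_kind_def)
  ultimately have "(2 * m) ^ n * (2 * m) \<le> cmod (weight J (U - {x})) * cmod (fac J u (card (kids (U - {x}) u)))"
    using assms(5) by (intro mult_mono) auto
  then show ?case
    by (simp add: last_site_step(2)[OF U(1,2) x u] norm_mult mult.commute)
qed

text \<open>Combines the coefficient of the pattern of \<open>U\<close> with the telescoped product;
  the patterns of smaller trees provide the strings that keep the earlier norms positive.\<close>

theorem prod_lanczos_b_ge_orders:
  fixes JX JY JZ hX hY hZ :: real and U :: "('d::finite) site set"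
  assumes "JX \<noteq> 0" "JY \<noteq> 0" and U: "forest U" "grown U" "card U = Suc n"
  shows "(2 * min \<bar>JX\<bar> \<bar>JY\<bar>) ^ n * card (orders U)
    \<le> (\<Prod>j=1..n. lanczos_b (ham_commutator JX JY JZ hX hY hZ) (at_site pauli_X (0 :: 'd site)) j)"
proof -
  let ?J = "coupling JX JY JZ" and ?h = "coupling hX hY hZ"
  let ?B = "kry ?J ?h :: nat \<Rightarrow> 'd string \<Rightarrow> complex"
  let ?m = "min \<bar>JX\<bar> \<bar>JY\<bar>"
  have ge: "(2 * ?m) ^ j * card (orders V) \<le> cmod (?B j (pattern V))"
    if "forest V" "grown V" "card V = Suc j" for V j
  proof -
    have fin: "finite V"
      using that(3) card.infinite by fastforce
    have "(2 * ?m) ^ j \<le> cmod (weight ?J V)"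
      using that fin by (intro norm_weight_ge) auto
    then show ?thesis
      by (simp add: kry_pattern[OF that(1) fin that(2,3)] norm_mult mult_right_mono)
  qed
  have zero: "?B i t = 0" if "card (supp t) = Suc j" "i < j" for i j t
    using kry_supp(2)[of ?J ?h i t] that by fastforce
  have unit: "ip (?B 0) (?B 0) = 1"
    by (simp add: ip_self)
  have indep: "\<exists>t. ?B j t \<noteq> 0 \<and> (\<forall>i<j. ?B i t = 0)" if "j < n" for j
  proof -
    obtain xs where xs: "growth xs" "set xs = U"
      using U(2) by (auto simp: grown_iff)
    then have len: "length xs = Suc n"
      using growth_distinct distinct_card U(3) by metis
    \<comment> \<open>A prefix of a growth order of \<open>U\<close> is a grown forest with
      \<open>j + 1\<close> sites, whose pattern is new at step \<open>j\<close>.\<close>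
    define V where "V = set (take (Suc j) xs)"
    have V: "forest V" "grown V" "card V = Suc j"
    proof -
      show "forest V"
        unfolding V_def using U(1) xs(2) set_take_subset by (metis forest_mono)
      show "grown V"
        unfolding V_def grown_iff using growth_take[OF xs(1), of "Suc j"] that len by auto
      show "card V = Suc j"
        unfolding V_def using that len growth_distinct[OF xs(1)]
        by (simp add: distinct_card)
    qed
    have "0 < (2 * ?m) ^ j"
      using assms(1,2) by (intro zero_less_power) (simp add: min_def)
    moreover have "0 < real (card (orders V))"
      using V(2) finite_orders[of V] by (simp add: card_gt_0_iff)
    ultimately have "0 < (2 * ?m) ^ j * card (orders V)"
      by (rule mult_pos_pos)
    also have "\<dots> \<le> cmod (?B j (pattern V))"
      using V by (rule ge)
    finally show ?thesis
      using zero[of "pattern V" j] V(3) by (intro exI[of _ "pattern V"]) auto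
  qed
  have "(2 * ?m) ^ n * card (orders U) \<le> cmod (?B n (pattern U))"
    using U by (rule ge)
  also have "\<dots> \<le> (\<Prod>j=1..n. lanczos_b (ham_commutator JX JY JZ hX hY hZ) (at_site pauli_X (0 :: 'd site)) j)"
  proof (rule prod_lanczos_b_ge)
    show "?B i (pattern U) = 0" if "i < n" for i
      using zero[of "pattern U" n] that U(3) by simp
  qed (use krylov_B_eq_lin unit indep in blast)+
  finally show ?thesis .
qed

section \<open>Planar trees with many growth orders\<close>

definition pup :: "nat \<times> nat \<Rightarrow> nat \<times> nat \<Rightarrow> bool" where
  "pup p q \<longleftrightarrow> q = (Suc (fst p), snd p) \<or> q = (fst p, Suc (snd p))"

text \<open>In the quadrant a site has at most two candidates for a parent, its left and its lower
  neighbour; the origin has none.\<close>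

definition pforest :: "(nat \<times> nat) set \<Rightarrow> bool" where
  "pforest T \<longleftrightarrow> (\<forall>a b. (Suc a, Suc b) \<in> T \<longrightarrow> (a, Suc b) \<notin> T \<or> (Suc a, b) \<notin> T)"

text \<open>Relative to the set \<open>W\<close> of sites already present, so that a growth can be
  replayed on top of other sites.\<close>

fun pgrow :: "(nat \<times> nat) set \<Rightarrow> (nat \<times> nat) list \<Rightarrow> bool" where
  "pgrow W [] \<longleftrightarrow> True"
| "pgrow W (x # xs) \<longleftrightarrow> x \<notin> W \<and> (\<exists>p\<in>W. pup p x) \<and> pgrow (insert x W) xs"

text \<open>The origin is not listed: an order of \<open>N\<close> sites has length
  \<open>N - 1\<close>.\<close>

definition porders :: "(nat \<times> nat) set \<Rightarrow> (nat \<times> nat) list set" where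
  "porders T = {xs. pgrow {(0, 0)} xs \<and> insert (0, 0) (set xs) = T}"

lemma pgrow_append: "pgrow W (xs @ ys) \<longleftrightarrow> pgrow W xs \<and> pgrow (W \<union> set xs) ys"
  by (induction xs arbitrary: W) simp_all

lemma pgrow_distinct: "pgrow W xs \<Longrightarrow> distinct xs \<and> W \<inter> set xs = {}"
  by (induction xs arbitrary: W) auto

lemma pgrow_mono:
  assumes "pgrow W xs" "W \<subseteq> V" "V \<inter> set xs = {}"
  shows "pgrow V xs"
  using assms
proof (induction xs arbitrary: W V)
  case (Cons x xs)
  have x: "pgrow (insert x W) xs" "x \<notin> set xs" and p: "\<exists>p\<in>W. pup p x"
    using Cons.prems(1) pgrow_distinct[of "insert x W" xs] by simp_all
  have "pgrow (insert x V) xs"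
  proof (rule Cons.IH[OF x(1)])
    show "insert x W \<subseteq> insert x V"
      using Cons.prems(2) by (rule insert_mono)
    show "insert x V \<inter> set xs = {}"
      using x(2) Cons.prems(3) by auto
  qed
  moreover have "x \<notin> V"
    using Cons.prems(3) by auto
  ultimately show ?case
    using p Cons.prems(2) by (simp only: pgrow.simps) blast
qed simp

text \<open>Sites added in the meantime do no harm: the parent remains present, and disjointness
  keeps each new site fresh. The number of shuffles supplies the binomial coefficient.\<close>

lemma pgrow_shuffles:
  assumes "pgrow W xs" "pgrow W ys" "set xs \<inter> set ys = {}" "zs \<in> shuffles xs ys"
  shows "pgrow W zs"
  using assms
proof (induction xs ys arbitrary: W zs rule: shuffles.induct)
  case (3 x xs y ys)
  from "3.prems"(4) consider zs' where "zs = x # zs'" "zs' \<in> shuffles xs (y # ys)"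
    | zs' where "zs = y # zs'" "zs' \<in> shuffles (x # xs) ys"
    by auto
  then show ?case
  proof cases
    case 1
    have "pgrow (insert x W) (y # ys)"
      using pgrow_distinct[OF "3.prems"(2)] "3.prems"(3) by (intro pgrow_mono[OF "3.prems"(2)]) auto
    then show ?thesis
      using "3.IH"(1)[of "insert x W" zs'] "3.prems" 1 by auto
  next
    case 2
    have "pgrow (insert y W) (x # xs)"
      using pgrow_distinct[OF "3.prems"(1)] "3.prems"(3) by (intro pgrow_mono[OF "3.prems"(1)]) auto
    then show ?thesis
      using "3.IH"(2)[of "insert y W" zs'] "3.prems" 2 by auto
  qed
qed auto

lemma pgrow_map:
  assumes "inj f" "\<And>p q. pup p q \<Longrightarrow> pup (f p) (f q)" "pgrow W xs"
  shows "pgrow (f ` W) (map f xs)"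
  using assms(3)
proof (induction xs arbitrary: W)
  case (Cons x xs)
  then have "pgrow (insert (f x) (f ` W)) (map f xs)"
    using Cons.IH[of "insert x W"] by simp
  moreover obtain p where "p \<in> W" "pup p x"
    using Cons.prems by auto
  then have "\<exists>p\<in>f ` W. pup p (f x)"
    using assms(2) by blast
  moreover have "f x \<notin> f ` W"
    using Cons.prems assms(1) by (simp add: inj_image_mem_iff)
  ultimately show ?case
    by simp
qed simp

lemma finite_porders: "finite (porders T)"
proof (cases "finite T")
  case True
  have "length xs \<le> card T" if "xs \<in> porders T" for xs
    using that True pgrow_distinct[of "{(0,0)}" xs] distinct_card[of xs] card_mono[of T "set xs"]
    by (auto simp: porders_def)
  then have "porders T \<subseteq> {xs. set xs \<subseteq> T \<and> length xs \<le> card T}"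
    by (auto simp: porders_def)
  with True show ?thesis
    using finite_lists_length_le finite_subset by blast
next
  case False
  then have "porders T = {}"
    by (auto simp: porders_def)
  then show ?thesis
    by simp
qed

lemma length_porders:
  assumes "xs \<in> porders T"
  shows "Suc (length xs) = card T"
proof -
  have "distinct xs" "(0, 0) \<notin> set xs"
    using assms pgrow_distinct[of "{(0,0)}" xs] by (auto simp: porders_def)
  then show ?thesis
    using assms distinct_card[of xs] by (auto simp: porders_def)
qed

text \<open>\<open>w\<close> and \<open>h\<close> are the largest coordinates allowed, so the box
  has \<open>w + 1\<close> columns and \<open>h + 1\<close> rows; \<open>c\<close> is only a lower
  bound.\<close>

definition tree_shape :: "nat \<Rightarrow> nat \<Rightarrow> nat \<Rightarrow> nat \<Rightarrow> bool" where
  "tree_shape w h N c \<longleftrightarrow> (\<exists>T \<subseteq> {0..w} \<times> {0..h}. (0, 0) \<in> T \<and> pforest T \<and> card T = N \<and>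
     c \<le> card (porders T))"

lemma tree_shape_swap:
  assumes "tree_shape w h N c"
  shows "tree_shape h w N c"
proof -
  obtain T where T: "T \<subseteq> {0..w} \<times> {0..h}" "(0, 0) \<in> T" "pforest T" "card T = N" "c \<le> card (porders T)"
    using assms by (auto simp: tree_shape_def)
  let ?T = "prod.swap ` T"
  have sub: "map prod.swap ` porders T \<subseteq> porders ?T"
  proof
    fix ys assume "ys \<in> map prod.swap ` porders T"
    then obtain xs where xs: "ys = map prod.swap xs" "pgrow {(0, 0)} xs" "insert (0, 0) (set xs) = T"
      by (auto simp: porders_def)
    have "pgrow (prod.swap ` {(0, 0)}) (map prod.swap xs)"
      using xs(2) by (intro pgrow_map) (auto simp: pup_def)
    with xs show "ys \<in> porders ?T"
      by (auto simp: porders_def image_iff)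
  qed
  have "inj_on (map prod.swap) (porders T)"
    using inj_mapI[OF inj_swap] by (rule inj_on_subset) simp
  then have "card (porders T) = card (map prod.swap ` porders T)"
    by (rule card_image[symmetric])
  also have "\<dots> \<le> card (porders ?T)"
    using sub finite_porders by (rule card_mono[rotated])
  finally have "c \<le> card (porders ?T)"
    using T(5) by simp
  moreover have "pforest ?T"
    using T(3) by (force simp: pforest_def)
  moreover have "card ?T = N"
    using T(4) by (simp add: card_image)
  moreover have "?T \<subseteq> {0..h} \<times> {0..w}" "(0, 0) \<in> ?T"
    using T(1,2) by force+
  ultimately show ?thesis
    unfolding tree_shape_def by blast
qed

text \<open>Two copies of a tree hang on a common stem: the bottom row, with one site above each of
  its ends. The copies lie two rows higher, so that they touch neither the stem nor each other
  except at their roots.\<close>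

lemma tree_shape_double:
  assumes "tree_shape w h N c"
  shows "tree_shape (2 * w + 2) (h + 2) (2 * N + w + 5) ((2 * N choose N) * c\<^sup>2)"
proof -
  obtain T where T: "T \<subseteq> {0..w} \<times> {0..h}" "(0, 0) \<in> T" "pforest T" "card T = N" "c \<le> card (porders T)"
    using assms by (auto simp: tree_shape_def)
  have finT: "finite T"
    using T(1) finite_subset by blast
  have le: "a \<le> w" "b \<le> h" if "(a, b) \<in> T" for a b
    using T(1) that by auto
  define f1 :: "nat \<times> nat \<Rightarrow> nat \<times> nat" where "f1 p = (fst p, snd p + 2)" for p
  \<comment> \<open>The shift by \<open>w + 2\<close> leaves column \<open>w + 1\<close> empty
    between the two copies.\<close>
  define f2 :: "nat \<times> nat \<Rightarrow> nat \<times> nat" where "f2 p = (fst p + w + 2, snd p + 2)" for p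
  have f: "inj f1" "inj f2" "\<And>p q. pup p q \<Longrightarrow> pup (f1 p) (f1 q)" "\<And>p q. pup p q \<Longrightarrow> pup (f2 p) (f2 q)"
    by (auto simp: f1_def f2_def inj_on_def pup_def)
  define row where "row = map (\<lambda>i. (Suc i, 0 :: nat)) [0..<w + 2]"
  define stem where "stem = row @ [(0, 1), (w + 2, 1)]"
  define S where "S = insert (0, 0) (set stem)"
  have set_row: "set row = {1..w + 2} \<times> {0}"
  proof (intro equalityI subsetI)
    fix p assume "p \<in> {1..w + 2} \<times> {0 :: nat}"
    then have "p = (Suc (fst p - 1), 0)" "fst p - 1 < w + 2"
      by auto
    then show "p \<in> set row"
      unfolding row_def by (metis (no_types, lifting) atLeast0LessThan image_eqI lessThan_iff list.set_map set_upt)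
  qed (auto simp: row_def)
  have S: "S = {0..w + 2} \<times> {0} \<union> {(0, 1), (w + 2, 1)}"
    unfolding S_def stem_def by (auto simp: set_row)
  have grow_row: "pgrow {(0, 0)} (map (\<lambda>i. (Suc i, 0 :: nat)) [0..<k])" for k
  proof (induction k)
    case (Suc k)
    then show ?case
      by (cases k) (auto simp: pgrow_append pup_def image_iff atLeast0_lessThan_Suc)
  qed simp
  have stem: "pgrow {(0, 0)} stem"
    unfolding stem_def pgrow_append set_row using grow_row[of "w + 2"]
    by (auto simp: row_def pup_def)
  define T' where "T' = S \<union> f1 ` T \<union> f2 ` T"
  have S12: "S \<inter> f1 ` T = {}" "S \<inter> f2 ` T = {}" "f1 ` T \<inter> f2 ` T = {}"
    using le by (fastforce simp: S f1_def f2_def)+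
  \<comment> \<open>The root of each copy is now an ordinary site to be added, so both lists have
    length \<open>N\<close> and there are \<open>2 * N choose N\<close> shuffles.\<close>
  define Z where "Z = (\<lambda>(xs, ys). shuffles (map f1 ((0, 0) # xs)) (map f2 ((0, 0) # ys)))"
  have set_copy: "set (map f1 ((0, 0) # xs)) = f1 ` T" "set (map f2 ((0, 0) # xs)) = f2 ` T"
    if "xs \<in> porders T" for xs
    using that by (auto simp: porders_def)
  have sub: "(\<lambda>zs. stem @ zs) ` (\<Union>xy \<in> porders T \<times> porders T. Z xy) \<subseteq> porders T'"
  proof clarify
    fix xs ys zs assume xs: "xs \<in> porders T" and ys: "ys \<in> porders T" and zs: "zs \<in> Z (xs, ys)"
    have copy: "pgrow S (map g ((0, 0) # ps))"
      if "ps \<in> porders T" and g: "inj g" "\<And>p q. pup p q \<Longrightarrow> pup (g p) (g q)"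
        and "S \<inter> g ` T = {}" and c: "c \<in> S" "pup c (g (0, 0))" for ps g c
    proof -
      have ps: "pgrow {(0, 0)} ps" "insert (0, 0) (set ps) = T"
        using that(1) by (auto simp: porders_def)
      have "pgrow {g (0, 0)} (map g ps)"
        using pgrow_map[of g "{(0, 0)}" ps] g ps by simp
      moreover have "insert (g (0, 0)) S \<inter> set (map g ps) = {}"
      proof -
        have "(0, 0) \<notin> set ps" "set ps \<subseteq> T"
          using pgrow_distinct[OF ps(1)] ps(2) by auto
        then show ?thesis
          using \<open>S \<inter> g ` T = {}\<close> g(1) by (auto simp: inj_image_mem_iff)
      qed
      ultimately have "pgrow (insert (g (0, 0)) S) (map g ps)"
        using pgrow_mono[of "{g (0, 0)}" "map g ps" "insert (g (0, 0)) S"] by simp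
      then show ?thesis
        using c \<open>S \<inter> g ` T = {}\<close> T(2) by auto
    qed
    have "pgrow S (map f1 ((0, 0) # xs))"
      by (rule copy[of _ f1 "(0, 1)"]) (use xs f S12 in \<open>auto simp: S f1_def pup_def\<close>)
    moreover have "pgrow S (map f2 ((0, 0) # ys))"
      by (rule copy[of _ f2 "(w + 2, 1)"]) (use ys f S12 in \<open>auto simp: S f2_def pup_def\<close>)
    moreover have "set (map f1 ((0, 0) # xs)) \<inter> set (map f2 ((0, 0) # ys)) = {}"
      using S12(3) unfolding set_copy(1)[OF xs] set_copy(2)[OF ys] .
    moreover have "zs \<in> shuffles (map f1 ((0, 0) # xs)) (map f2 ((0, 0) # ys))"
      using zs by (simp only: Z_def prod.case)
    ultimately have "pgrow S zs"
      by (rule pgrow_shuffles)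
    moreover have "set zs = f1 ` T \<union> f2 ` T"
      using set_shuffles[of zs "map f1 ((0, 0) # xs)" "map f2 ((0, 0) # ys)"] zs
        set_copy(1)[OF xs] set_copy(2)[OF ys] unfolding Z_def by auto
    ultimately show "stem @ zs \<in> porders T'"
      using stem by (auto simp: porders_def pgrow_append S_def T'_def)
  qed
  \<comment> \<open>A shuffle determines its two ingredients: they are its restrictions to the two
    copies.\<close>
  have Z_disjoint: "Z xy \<inter> Z xy' = {}"
    if "xy \<in> porders T \<times> porders T" "xy' \<in> porders T \<times> porders T" "xy \<noteq> xy'" for xy xy'
  proof (rule ccontr)
    assume "Z xy \<inter> Z xy' \<noteq> {}"
    then obtain zs where zs: "zs \<in> Z xy" "zs \<in> Z xy'"
      by blast
    have copies: "filter (\<lambda>p. p \<in> f1 ` T) zs = map f1 ((0, 0) # fst v)"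
      "filter (\<lambda>p. p \<notin> f1 ` T) zs = map f2 ((0, 0) # snd v)"
      if "v \<in> porders T \<times> porders T" "zs \<in> Z v" for v
      using filter_shuffles_disjoint1[of "map f1 ((0, 0) # fst v)" "map f2 ((0, 0) # snd v)" zs]
        that set_copy[of "fst v"] set_copy[of "snd v"] S12(3)
      by (auto simp: Z_def simp del: list.map list.set)
    have "map f1 ((0, 0) # fst xy) = map f1 ((0, 0) # fst xy')"
      "map f2 ((0, 0) # snd xy) = map f2 ((0, 0) # snd xy')"
      using copies[OF that(1) zs(1)] copies[OF that(2) zs(2)] by simp_all
    then have "xy = xy'"
      using f(1,2) by (auto simp: prod_eq_iff inj_map_eq_map)
    with that(3) show False
      by simp
  qed
  have card_Z: "card (Z xy) = 2 * N choose N" if in_T: "xy \<in> porders T \<times> porders T" for xy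
  proof -
    obtain xs ys where xy: "xy = (xs, ys)" "xs \<in> porders T" "ys \<in> porders T"
      using in_T by auto
    have len: "length (map f1 ((0, 0) # xs)) = N" "length (map f2 ((0, 0) # ys)) = N"
      using length_porders[OF xy(2)] length_porders[OF xy(3)] T(4) by auto
    have "card (Z xy) = (length (map f1 ((0, 0) # xs)) + length (map f2 ((0, 0) # ys)))
        choose length (map f1 ((0, 0) # xs))"
      unfolding xy(1) Z_def prod.case
      using set_copy(1)[OF xy(2)] set_copy(2)[OF xy(3)] S12(3)
      by (intro card_disjoint_shuffles) simp
    then show ?thesis
      unfolding len by (simp add: mult_2)
  qed
  have "(2 * N choose N) * c\<^sup>2 \<le> (2 * N choose N) * (card (porders T))\<^sup>2"
    using T(5) by (simp add: power_mono)
  also have "\<dots> = (\<Sum>xy\<in>porders T \<times> porders T. card (Z xy))"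
    by (simp add: card_Z card_cartesian_product power2_eq_square)
  also have "\<dots> = card (\<Union>xy \<in> porders T \<times> porders T. Z xy)"
    using finite_porders Z_disjoint
    by (intro card_UN_disjoint[symmetric]) (auto simp: Z_def)
  also have "\<dots> = card ((\<lambda>zs. stem @ zs) ` (\<Union>xy \<in> porders T \<times> porders T. Z xy))"
    by (rule card_image[symmetric]) (simp add: inj_on_def)
  also have "\<dots> \<le> card (porders T')"
    using sub finite_porders by (rule card_mono[rotated])
  finally have count: "(2 * N choose N) * c\<^sup>2 \<le> card (porders T')" .
  have mem: "(a, b) \<in> T' \<longleftrightarrow> b = 0 \<and> a \<le> w + 2 \<or> b = 1 \<and> (a = 0 \<or> a = w + 2)
      \<or> 2 \<le> b \<and> (a, b - 2) \<in> T \<or> w + 2 \<le> a \<and> 2 \<le> b \<and> (a - (w + 2), b - 2) \<in> T" for a b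
  proof -
    have "(a, b) \<in> f1 ` T \<longleftrightarrow> 2 \<le> b \<and> (a, b - 2) \<in> T"
      by (force simp: f1_def image_iff)
    moreover have "(a, b) \<in> f2 ` T \<longleftrightarrow> w + 2 \<le> a \<and> 2 \<le> b \<and> (a - (w + 2), b - 2) \<in> T"
      by (force simp: f2_def image_iff)
    ultimately show ?thesis
      by (auto simp: T'_def S)
  qed
  have "pforest T'"
    unfolding pforest_def
  proof (intro allI impI)
    fix a b assume ab: "(Suc a, Suc b) \<in> T'"
    show "(a, Suc b) \<notin> T' \<or> (Suc a, b) \<notin> T'"
    proof (rule ccontr)
      assume "\<not> ?thesis"
      then have l: "(a, Suc b) \<in> T'" and d: "(Suc a, b) \<in> T'"
        by auto
      consider "b = 0" | "b = 1" | b' where "b = Suc (Suc b')"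
        by (metis One_nat_def not0_implies_Suc)
      then show False
      proof cases
        case 1
        then show False
          using ab l by (auto simp: mem)
      next
        \<comment> \<open>In row 2 only the root of the second copy has both a site below it and a
          column to its left, and that column is empty.\<close>
        case 2
        then have "Suc a = w + 2"
          using d by (auto simp: mem)
        then show False
          using l 2 le(1)[of a] by (auto simp: mem)
      next
        case 3
        consider "(Suc a, Suc b') \<in> T" | "w + 2 \<le> Suc a" "(Suc a - (w + 2), Suc b') \<in> T"
          using ab 3 by (auto simp: mem)
        then show False
        proof cases
          case 1
          then have "Suc a \<le> w"
            by (rule le)
          then show False
            using 1 l d 3 T(3) by (auto simp: mem pforest_def)
        next
          case 2
          have "(a, Suc b') \<notin> T" "(Suc a, b') \<notin> T"
            using 2(1) le(1)[of a] le(1)[of "Suc a"] by auto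
          then have "w + 2 \<le> a" "(a - (w + 2), Suc b') \<in> T" "(Suc a - (w + 2), b') \<in> T"
            using l d 3 by (auto simp: mem)
          then show False
            using 2(2) T(3) Suc_diff_le[of "w + 2" a] unfolding pforest_def by metis
        qed
      qed
    qed
  qed
  moreover have "card T' = 2 * N + w + 5"
  proof -
    have "card S = w + 5"
      unfolding S by (subst card_Un_disjoint) (auto simp: card_cartesian_product)
    moreover have "card (f1 ` T) = N" "card (f2 ` T) = N"
      using T(4) f(1,2) by (auto simp: card_image inj_on_subset)
    moreover have "finite S"
      unfolding S by simp
    ultimately show ?thesis
      unfolding T'_def using S12 finT by (subst card_Un_disjoint; (subst card_Un_disjoint)?) auto
  qed
  moreover have "T' \<subseteq> {0..2 * w + 2} \<times> {0..h + 2}"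
    using le by (fastforce simp: mem)
  moreover have "(0, 0) \<in> T'"
    by (simp add: mem)
  ultimately show ?thesis
    unfolding tree_shape_def using count by blast
qed

text \<open>The exchange of the coordinates makes the next doubling act on the other side of the
  box.\<close>

lemma tree_shape_step:
  assumes "tree_shape w h N c"
  shows "tree_shape (h + 2) (2 * w + 2) (2 * N + w + 5) ((2 * N choose N) * c\<^sup>2)"
  using assms by (intro tree_shape_swap[OF tree_shape_double])

lemma tree_shape_base: "tree_shape 0 0 1 1"
proof -
  have "porders {(0, 0)} = {[]}"
    using length_porders[of _ "{(0, 0)}"] by (auto simp: porders_def)
  then show ?thesis
    unfolding tree_shape_def by (intro exI[of _ "{(0, 0)}"]) (auto simp: pforest_def)
qed

section \<open>Growth orders compared with the factorial\<close>

text \<open>The price of the stem: its \<open>j\<close> sites add factors to the factorial, each at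
  most \<open>m + j\<close>, without adding to the count of orders.\<close>

lemma fact_add_le: "fact (m + j) \<le> (fact m * (m + j) ^ j :: nat)"
proof (induction j)
  case (Suc j)
  have "fact (m + Suc j) = (m + Suc j) * fact (m + j)"
    by simp
  also have "\<dots> \<le> (m + Suc j) * (fact m * (m + j) ^ j)"
    using Suc by (rule mult_left_mono) simp
  also have "\<dots> \<le> (m + Suc j) * (fact m * (m + Suc j) ^ j)"
    by (intro mult_left_mono power_mono) auto
  finally show ?case
    by (simp add: mult_ac)
qed simp

lemma central_binomial_ln:
  "ln (real (2 * N choose N)) = ln (fact (2 * N)) - 2 * ln (fact N)"
proof -
  have "(fact N * fact N * (2 * N choose N) :: real) = fact (2 * N)"
    using binomial_fact_lemma[of N "2 * N"] by (metis (no_types, lifting) diff_add_inverse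
      le_add1 mult_2 of_nat_fact of_nat_mult)
  moreover have "ln (fact N * fact N * real (2 * N choose N))
      = ln (fact N) + ln (fact N) + ln (real (2 * N choose N))"
    by (simp add: ln_mult)
  ultimately show ?thesis
    by simp
qed

text \<open>The deficit \<open>ln N! - ln c\<close> at most doubles at each step, up to \<open>(w + 5) ln N\<close>, which is
  only of order \<open>k 2 ^ (k / 2)\<close> because the side lengths of the trees double every two steps.\<close>

lemma tree_shapes:
  "\<exists>w h N c. tree_shape w h N c \<and> real w + 4 \<le> 6 * sqrt 2 ^ k \<and> real h + 6 \<le> 6 * sqrt 2 ^ Suc k
     \<and> 2 ^ k \<le> N \<and> N \<le> 2 ^ (2 * k + 3) \<and> 1 \<le> c
     \<and> ln (fact N) - ln (real c) \<le> 154 * 2 ^ k - (28 * real k + 154) * sqrt 2 ^ k"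
proof (induction k)
  case 0
  have "sqrt 2 \<ge> 1"
    by simp
  then show ?case
    using tree_shape_base by (intro exI[of _ 0] exI[of _ 1]) auto
next
  case (Suc k)
  then obtain w h N c where IH: "tree_shape w h N c" "real w + 4 \<le> 6 * sqrt 2 ^ k"
      "real h + 6 \<le> 6 * sqrt 2 ^ Suc k" "2 ^ k \<le> N" "N \<le> 2 ^ (2 * k + 3)" "1 \<le> c"
      "ln (fact N) - ln (real c) \<le> 154 * 2 ^ k - (28 * real k + 154) * sqrt 2 ^ k"
    by blast
  define r where "r = sqrt 2 ^ k"
  have sqrt2: "sqrt 2 \<le> 3 / 2"
    by (rule real_le_lsqrt) (simp_all add: power2_eq_square)
  have r: "1 \<le> r" "r \<le> 2 ^ k"
    using sqrt2 by (auto simp: r_def intro!: power_mono)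
  let ?N = "2 * N + w + 5" and ?c = "(2 * N choose N) * c\<^sup>2"
  have w: "real w + 5 \<le> 7 * r"
    using IH(2)[folded r_def] r by linarith
  \<comment> \<open>A crude bound suffices, since only the logarithm of the size enters the loss; it
    makes that logarithm linear in \<open>k\<close>.\<close>
  have N_le: "?N \<le> 2 ^ (2 * Suc k + 3)"
  proof -
    have "real w + 5 \<le> 16 * (2 ^ k * 2 ^ k)"
    proof -
      have "2 ^ k * 1 \<le> (2 ^ k * 2 ^ k :: real)"
        by (intro mult_left_mono) auto
      then show ?thesis
        using w r by linarith
    qed
    moreover have "(2 :: real) ^ (2 * k + 3) = 8 * (2 ^ k * 2 ^ k)" "(2 :: real) ^ (2 * Suc k + 3) = 32 * (2 ^ k * 2 ^ k)"
      by (simp_all only: mult_2 power_add) simp_all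
    moreover have "real N \<le> 2 ^ (2 * k + 3)"
      using IH(5) by (metis of_nat_le_iff of_nat_numeral of_nat_power)
    ultimately have "real ?N \<le> 2 ^ (2 * Suc k + 3)"
      by simp
    then show ?thesis
      by (metis of_nat_le_iff of_nat_numeral of_nat_power)
  qed
  have ln_N: "ln (real ?N) \<le> 2 * real k + 5"
  proof -
    have "real ?N \<le> real (2 ^ (2 * Suc k + 3))"
      using N_le by (simp only: of_nat_le_iff)
    then have "ln (real ?N) \<le> ln (2 ^ (2 * Suc k + 3))"
      by (intro ln_mono) auto
    also have "\<dots> = (2 * real k + 5) * ln 2"
      by (subst ln_realpow) auto
    also have "\<dots> \<le> (2 * real k + 5) * 1"
      using ln_2_less_1 by (intro mult_left_mono) auto
    finally show ?thesis
      by simp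
  qed
  have "(fact ?N :: real) \<le> fact (2 * N) * real ?N ^ (w + 5)"
    using fact_add_le[of "2 * N" "w + 5"] by (metis (no_types, lifting) add.assoc of_nat_fact
      of_nat_le_iff of_nat_mult of_nat_power)
  then have "ln (fact ?N :: real) \<le> ln (fact (2 * N) * real ?N ^ (w + 5))"
    by (intro ln_mono) auto
  also have "\<dots> = ln (fact (2 * N)) + (real w + 5) * ln (real ?N)"
    by (subst ln_mult) (auto simp: ln_realpow)
  finally have fact_N: "ln (fact ?N :: real) \<le> ln (fact (2 * N)) + (real w + 5) * ln (real ?N)" .
  have err: "(real w + 5) * ln (real ?N) \<le> 7 * r * (2 * real k + 5)"
    using w ln_N r by (intro mult_mono) auto
  have "real ?c = real (2 * N choose N) * real c ^ 2"
    by simp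
  then have ln_c: "ln (real ?c) = ln (fact (2 * N)) - 2 * ln (fact N) + 2 * ln (real c)"
    using IH(6) central_binomial_ln[of N] by (simp add: ln_mult ln_realpow)
  have "ln (fact ?N) - ln (real ?c) \<le> 2 * (ln (fact N) - ln (real c)) + 7 * r * (2 * real k + 5)"
  proof -
    have "a - z \<le> 2 * (p - q) + y" if "a \<le> b + x" "x \<le> y" "z = b - 2 * p + 2 * q"
      for a b p q x y z :: real
    proof -
      have "2 * (p - q) = 2 * p - 2 * q"
        by (rule right_diff_distrib)
      then show ?thesis
        using that by linarith
    qed
    from this[OF fact_N err ln_c] show ?thesis .
  qed
  also have "\<dots> \<le> 2 * (154 * 2 ^ k - (28 * real k + 154) * r) + 7 * r * (2 * real k + 5)"
    using IH(7) by (simp add: r_def)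
  \<comment> \<open>With B = 28 and A = 154 both sides are equal: 2B - 14 = 3B/2 compares the terms
    in \<open>k\<close>, and 2A - 35 = 3(A + B)/2 the constant ones. Here 3/2 stands in for
    \<open>sqrt 2\<close>. The same A in front of \<open>2 ^ k\<close> makes the bound 0 at
    \<open>k = 0\<close>.\<close>
  also have "\<dots> \<le> 154 * 2 ^ Suc k - (28 * real (Suc k) + 154) * (3 / 2 * r)"
    by (simp add: algebra_simps)
  also have "\<dots> \<le> 154 * 2 ^ Suc k - (28 * real (Suc k) + 154) * (sqrt 2 * r)"
    using sqrt2 r by (intro diff_left_mono mult_left_mono mult_right_mono) auto
  finally have deficit: "ln (fact ?N) - ln (real ?c)
      \<le> 154 * 2 ^ Suc k - (28 * real (Suc k) + 154) * sqrt 2 ^ Suc k"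
    by (simp add: r_def)
  have "tree_shape (h + 2) (2 * w + 2) ?N ?c"
    using IH(1) by (rule tree_shape_step)
  \<comment> \<open>Over two steps \<open>w\<close> becomes \<open>2 * w + 4\<close> and
    \<open>h\<close> becomes \<open>2 * h + 6\<close>; the offsets 4 and 6 are those for which the
    shifted sides double exactly.\<close>
  moreover have "real (h + 2) + 4 \<le> 6 * sqrt 2 ^ Suc k"
    using IH(3) by simp
  moreover have "real (2 * w + 2) + 6 \<le> 6 * sqrt 2 ^ Suc (Suc k)"
  proof -
    have sqrt_Suc: "sqrt 2 ^ Suc (Suc k) = 2 * sqrt 2 ^ k"
      by (simp flip: mult.assoc)
    show ?thesis
      unfolding sqrt_Suc using IH(2) by simp
  qed
  moreover have "2 ^ Suc k \<le> ?N"
    using IH(4) by simp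
  moreover have "1 \<le> ?c"
    using IH(6) by (simp add: Suc_le_eq)
  ultimately show ?case
    using N_le deficit by blast
qed

section \<open>Trees on the lattice\<close>

definition plane :: "'d::finite \<Rightarrow> 'd \<Rightarrow> nat \<times> nat \<Rightarrow> 'd site" where
  "plane i j p = axis i (int (fst p)) + axis j (int (snd p))"

lemma plane_nth:
  assumes "i \<noteq> j"
  shows "plane i j p $ k = (if k = i then int (fst p) else if k = j then int (snd p) else 0)"
  using assms by (auto simp: plane_def axis_def)

lemma plane_inj:
  assumes "i \<noteq> j"
  shows "inj (plane i j)"
proof (rule injI)
  fix p q assume eq: "plane i j p = plane i j q"
  have "fst p = fst q" "snd p = snd q"
    using arg_cong[OF eq, of "\<lambda>v. v $ i"] arg_cong[OF eq, of "\<lambda>v. v $ j"] assms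
    by (auto simp: plane_nth)
  then show "p = q"
    by (simp add: prod_eq_iff)
qed

lemma plane_zero: "plane i j (0, 0) = 0"
  by (simp add: plane_def vec_eq_iff axis_def)

text \<open>An equivalence, because \<open>forest\<close> speaks of all lattice steps between sites
  of the set: the embedding must not create new ones.\<close>

lemma up_plane_iff:
  assumes "i \<noteq> j"
  shows "up (plane i j p) (plane i j q) \<longleftrightarrow> pup p q"
proof
  assume "up (plane i j p) (plane i j q)"
  then obtain k where k: "plane i j q = plane i j p + axis k 1"
    by (auto simp: up_def)
  have *: "plane i j q $ l = plane i j p $ l + (if l = k then 1 else 0)" for l
    unfolding k by (simp add: axis_def)
  have "k = i \<or> k = j"
    using *[of k] assms by (auto simp: plane_nth split: if_splits)
  with *[of i] *[of j] assms show "pup p q"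
    by (cases q) (auto simp: plane_nth pup_def split: if_splits)
next
  assume "pup p q"
  then have "plane i j q = plane i j p + axis i 1 \<or> plane i j q = plane i j p + axis j 1"
    using assms by (auto simp: pup_def vec_eq_iff plane_nth axis_def)
  then show "up (plane i j p) (plane i j q)"
    by (auto simp: up_def)
qed

lemma forest_plane:
  assumes "i \<noteq> j" "pforest T"
  shows "forest (plane i j ` T)"
proof -
  have "\<not> up (plane i j p) 0" for p
    using up_plane_iff[OF assms(1), of p "(0, 0)"] by (auto simp: plane_zero pup_def)
  moreover have "p = p'" if "p \<in> T" "p' \<in> T" "q \<in> T" "pup p q" "pup p' q" for p p' q
    using that assms(2) by (cases p; cases p') (auto simp: pup_def pforest_def)
  ultimately show ?thesis
    unfolding forest_def using up_plane_iff[OF assms(1)] by blast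
qed

lemma growth_plane:
  assumes "i \<noteq> j" "pgrow W ys" "growth xs" "set xs = plane i j ` W"
  shows "growth (xs @ map (plane i j) ys)"
  using assms(2-4)
proof (induction ys arbitrary: W xs)
  case (Cons y ys)
  then obtain p where p: "p \<in> W" "pup p y" and y: "y \<notin> W" "pgrow (insert y W) ys"
    by auto
  have "growth (xs @ [plane i j y])"
    using Cons.prems p y up_plane_iff[OF assms(1), of p y] plane_inj[OF assms(1)]
    by (intro growth_snoc[where u = "plane i j p"]) (auto simp: nbr_def inj_image_mem_iff)
  then have "growth ((xs @ [plane i j y]) @ map (plane i j) ys)"
    using y(2) Cons.prems(3) by (intro Cons.IH[of "insert y W"]) auto
  then show ?case
    by simp
qed simp

lemma card_orders_plane:
  assumes "i \<noteq> j"
  shows "card (porders T) \<le> card (orders (plane i j ` T))"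
proof -
  let ?f = "\<lambda>ys. 0 # map (plane i j) ys"
  have "?f ` porders T \<subseteq> orders (plane i j ` T)"
  proof
    fix xs assume "xs \<in> ?f ` porders T"
    then obtain ys where ys: "xs = ?f ys" "pgrow {(0, 0)} ys" "insert (0, 0) (set ys) = T"
      by (auto simp: porders_def)
    have "growth ([0] @ map (plane i j) ys)"
      using ys(2) by (intro growth_plane[OF assms]) (auto simp: growth_init plane_zero)
    moreover have "set xs = plane i j ` T"
      using ys by (auto simp: plane_zero)
    ultimately show "xs \<in> orders (plane i j ` T)"
      using ys(1) by (simp add: orders_def)
  qed
  moreover have "inj_on ?f (porders T)"
    using plane_inj[OF assms] by (auto simp: inj_on_def inj_map_eq_map)
  ultimately show ?thesis
    by (metis card_image card_mono finite_orders)
qed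

theorem theoremA4:
  fixes JX JY JZ hX hY hZ :: real
  assumes "CARD('d::finite) \<ge> 2"
    and "JX \<noteq> 0" and "JY \<noteq> 0"
  shows "\<exists>\<alpha>::real. \<alpha> > 0 \<and> (\<exists>G::nat set. infinite G \<and> (\<forall>n\<in>G. n > 0) \<and>
    (\<forall>n\<in>G. (\<Prod>j=1..n. lanczos_b (ham_commutator JX JY JZ hX hY hZ)
        (at_site pauli_X (0 :: 'd site)) j) \<ge> \<alpha> ^ n * fact n))"
proof -
  let ?P = "\<lambda>n. \<Prod>j=1..n. lanczos_b (ham_commutator JX JY JZ hX hY hZ) (at_site pauli_X (0 :: 'd site)) j"
  define m where "m = min \<bar>JX\<bar> \<bar>JY\<bar>"
  have m: "m > 0"
    using assms(2,3) by (simp add: m_def)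
  \<comment> \<open>\<open>2 * m\<close> is the gain per commutator. The deficit is at most
    \<open>154 * 2 ^ k\<close>, hence at most \<open>154 * N\<close>, and \<open>N = n + 1\<close>
    is at most \<open>2 * n\<close>, which gives 308.\<close>
  define \<alpha> where "\<alpha> = 2 * m * exp (- 308)"
  \<comment> \<open>The dimension enters here: the trees need a coordinate plane.\<close>
  obtain i j :: 'd where ij: "i \<noteq> j"
  proof -
    have "\<not> CARD('d) \<le> Suc 0"
      using assms(1) by simp
    then show thesis
      using that by (auto simp: card_le_Suc0_iff_eq)
  qed
  have good: "\<exists>n. 2 ^ k \<le> Suc n \<and> n > 0 \<and> \<alpha> ^ n * fact n \<le> ?P n" if k: "k > 0" for k
  proof -
    obtain w h N c where shape: "tree_shape w h N c" "2 ^ k \<le> N" "1 \<le> c"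
      and deficit: "ln (fact N) - ln (real c) \<le> 154 * 2 ^ k - (28 * real k + 154) * sqrt 2 ^ k"
      using tree_shapes by blast
    obtain T where T: "pforest T" "card T = N" "c \<le> card (porders T)"
      using shape(1) by (auto simp: tree_shape_def)
    \<comment> \<open>The origin is present from the start, so a tree with \<open>N\<close> sites is
      complete after \<open>N - 1\<close> commutators.\<close>
    define n where "n = N - 1"
    have "(2 :: nat) ^ 1 \<le> 2 ^ k"
      using k by (intro power_increasing) auto
    then have n: "N = Suc n" "n > 0"
      using shape(2) by (auto simp: n_def)
    let ?U = "plane i j ` T"
    have c_le: "c \<le> card (orders ?U)"
      using T(3) card_orders_plane[OF ij, of T] by (rule order_trans)
    have U: "forest ?U" "grown ?U" "card ?U = Suc n"
    proof -
      show "forest ?U"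
        using ij T(1) by (rule forest_plane)
      show "grown ?U"
        using c_le shape(3) by auto
      show "card ?U = Suc n"
        using T(2) n plane_inj[OF ij] by (simp add: card_image inj_on_subset)
    qed
    have "ln (fact N) - ln (real c) \<le> 308 * real n"
    proof -
      have "(28 * real k + 154) * sqrt 2 ^ k \<ge> 0"
        by simp
      moreover have "(2 :: real) ^ k \<le> real N"
        using shape(2) by (metis of_nat_le_iff of_nat_numeral of_nat_power)
      moreover have "real N \<le> 2 * real n"
        using n by simp
      ultimately show ?thesis
        using deficit by linarith
    qed
    then have "ln (fact N :: real) \<le> ln (real c * exp (308 * real n))"
      using shape(3) by (simp add: ln_mult)
    then have "(fact N :: real) \<le> real c * exp (308 * real n)"
      using shape(3) by (subst (asm) ln_le_cancel_iff) auto
    moreover have "(fact n :: real) \<le> fact N"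
      unfolding n(1) by (rule fact_mono) simp
    ultimately have fact: "(fact n :: real) \<le> real c * exp (308 * real n)"
      by linarith
    have "\<alpha> ^ n * fact n = (2 * m) ^ n * (exp (- (308 * real n)) * fact n)"
      by (simp add: \<alpha>_def power_mult_distrib flip: exp_of_nat_mult)
    also have "\<dots> \<le> (2 * m) ^ n * real c"
    proof (rule mult_left_mono)
      have "exp (- (308 * real n)) * fact n \<le> exp (- (308 * real n)) * (real c * exp (308 * real n))"
        using fact by (intro mult_left_mono) auto
      also have "\<dots> = real c"
        by (simp add: exp_minus)
      finally show "exp (- (308 * real n)) * fact n \<le> real c" .
    qed (use m in simp)
    also have "\<dots> \<le> (2 * m) ^ n * real (card (orders ?U))"
      using c_le m by (intro mult_left_mono) auto
    also have "\<dots> \<le> ?P n"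
      unfolding m_def using assms(2,3) U by (rule prod_lanczos_b_ge_orders)
    finally show ?thesis
      using n shape(2) by auto
  qed
  define G where "G = {n. n > 0 \<and> \<alpha> ^ n * fact n \<le> ?P n}"
  \<comment> \<open>The tree sizes are at least \<open>2 ^ k\<close>, so the good indices are
    unbounded, although only those that come from the constructed trees are controlled.\<close>
  have "\<exists>n\<in>G. k \<le> n" for k
  proof -
    obtain n where n: "2 ^ Suc k \<le> Suc n" "n \<in> G"
      using good[of "Suc k"] by (auto simp: G_def)
    have "Suc k < 2 ^ Suc k"
      by (rule less_exp)
    then have "k \<le> n"
      using n(1) by linarith
    with n(2) show ?thesis
      by blast
  qed
  then have "infinite G"
    unfolding infinite_nat_iff_unbounded_le by blast
  moreover have "\<alpha> > 0"
    using m by (simp add: \<alpha>_def)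
  ultimately show ?thesis
    by (intro exI[of _ \<alpha>] exI[of _ G] conjI) (auto simp: G_def)
qed

end
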